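(* Let $(a,b,c)$ be an admissible triple with $\alpha=\tfrac12(-a+b+c)$, $\beta=\tfrac12(a-b+c)$, $\gamma=\tfrac12(a+b-c)$. Written as a polynomial in $x=\mathrm{tr}(\mathbf{x}_1)$, $y=\mathrm{tr}(\mathbf{x}_2)$, $z=\mathrm{tr}(\mathbf{x}_1\mathbf{x}_2^{-1})$, the central function $\chi^{a,b,c}$ is monic with highest degree monomial $x^\beta y^\alpha z^\gamma$; that is, $\chi^{a,b,c}-x^\beta y^\alpha z^\gamma$ is a polynomial in $x,y,z$ of total degree strictly less than $\alpha+\beta+\gamma$.
   Context: Let $G=\mathrm{SL}(2,\mathbb{C})$ and $V=\mathbb{C}^2$ with standard basis $e_1,e_2$. A triple $(a,b,c)$ of nonnegative integers is admissible if $\alpha=\tfrac12(-a+b+c)$, $\beta=\tfrac12(a-b+c)$, $\gamma=\tfrac12(a+b-c)$ are all nonnegative integers. Let $P_n:V^{\otimes n}\to V^{\otimes n}$ be the symmetrizer $v_1\otimes\cdots\otimes v_n\mapsto\frac1{n!}\sum_{\sigma\in\Sigma_n}v_{\sigma(1)}\otimes\cdots\otimes v_{\sigma(n)}$, and let $V_n\subset V^{\otimes n}$ be its image (isomorphic to $\mathrm{Sym}^nV$). Let $\mathrm{cup}:\mathbb{C}\to V\otimes V$, $1\mapsto e_1\otimes e_2-e_2\otimes e_1$, and $\mathrm{cap}:V\otimes V\to\mathbb{C}$, $v\otimes w\mapsto\det[v\ w]$. Define nested versions by $\mathrm{cup}_0=\mathrm{cap}_0=1$, $\mathrm{cup}_n=(\mathrm{id}_{V^{\otimes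 (n-1)}}\otimes\mathrm{cup}\otimes\mathrm{id}_{V^{\otimes (n-1)}})\circ\mathrm{cup}_{n-1}:\mathbb{C}\to V^{\otimes n}\otimes V^{\otimes n}$, $\mathrm{cap}_n=\mathrm{cap}_{n-1}\circ(\mathrm{id}_{V^{\otimes (n-1)}}\otimes\mathrm{cap}\otimes\mathrm{id}_{V^{\otimes (n-1)}}):V^{\otimes n}\otimes V^{\otimes n}\to\mathbb{C}$. For an admissible triple define $\iota^{a,b}_c=(P_a\otimes P_b)\circ(\mathrm{id}_{V^{\otimes\beta}}\otimes\mathrm{cup}_\gamma\otimes\mathrm{id}_{V^{\otimes\alpha}})|_{V_c}:V_c\to V_a\otimes V_b$ and $\pi^c_{a,b}=P_c\circ(\mathrm{id}_{V^{\otimes\beta}}\otimes\mathrm{cap}_\gamma\otimes\mathrm{id}_{V^{\otimes\alpha}})|_{V_a\otimes V_b}:V_a\otimes V_b\to V_c$. The central function $\chi^{a,b,c}:G\times G\to\mathbb{C}$ is $\chi^{a,b,c}(\mathbf{x}_1,\mathbf{x}_2)=\mathrm{tr}_{V_c}\big(\pi^c_{a,b}\circ(\mathbf{x}_1^{\otimes a}\otimes\mathbf{x}_2^{\otimes b})\circ\iota^{a,b}_c\big)$. It is known that $\chi^{a,b,c}$ is expressed by a unique polynomial in the three trace functions $x,y,z$, which are algebraically independent functions on $G\times G$. *)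

theory Defs
  imports
    "HOL-Analysis.Analysis"
    "HOL-Combinatorics.Permutations"
    "HOL-Library.Function_Algebras"
    "HOL-Library.Poly_Mapping"
begin

section \<open>Tensor powers of the plane\<close>

text \<open>
  A tensor over V = C^2 is given by its coordinates in the basis
  e_(i_1) (x) ... (x) e_(i_n) of the tensor algebra, which is indexed by the words
  [i_1, ..., i_n] over the two-element index type \<open>2\<close>, whose elements are \<open>1\<close> and \<open>2\<close> (= \<open>0\<close>).
  The n-th tensor power consists of the functions supported on words of length n; in particular
  the 0-th tensor power is C, the scalar being the coordinate at the empty word.
  Linear maps between tensor powers are functions on the type of all tensors; only their values
  on the relevant tensor power matter.
\<close>

type_synonym tensor = "2 list \<Rightarrow> complex"

definition tscale :: "complex \<Rightarrow> tensor \<Rightarrow> tensor" where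
  "tscale c t = (\<lambda>w. c * t w)"

interpretation tsp: vector_space tscale
  by unfold_locales (auto simp: tscale_def fun_eq_iff algebra_simps)

definition words :: "nat \<Rightarrow> 2 list set" where
  "words n = {w. length w = n}"

definition tpower :: "nat \<Rightarrow> tensor set" where
  "tpower n = {t. \<forall>w. w \<notin> words n \<longrightarrow> t w = 0}"

definition pure_tensor :: "(complex^2) list \<Rightarrow> tensor" where
  "pure_tensor vs =
     (\<lambda>w. if length w = length vs then \<Prod>i<length vs. (vs ! i) $ (w ! i) else 0)"

definition basis_tensor :: "2 list \<Rightarrow> tensor" where
  "basis_tensor w = pure_tensor (map (\<lambda>i. axis i 1) w)"

definition otimes :: "tensor \<Rightarrow> tensor \<Rightarrow> tensor" where
  "otimes s t = (\<lambda>w. \<Sum>k\<le>length w. s (take k w) * t (drop k w))"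

text \<open>The linear map on the n-th tensor power with prescribed values on the basis.\<close>

definition lin_ext :: "nat \<Rightarrow> (2 list \<Rightarrow> tensor) \<Rightarrow> tensor \<Rightarrow> tensor" where
  "lin_ext n F t = (\<Sum>w\<in>words n. tscale (t w) (F w))"

text \<open>The tensor product of linear maps f and g defined on the m-th and n-th tensor power.\<close>

definition map_otimes ::
    "nat \<Rightarrow> nat \<Rightarrow> (tensor \<Rightarrow> tensor) \<Rightarrow> (tensor \<Rightarrow> tensor) \<Rightarrow> tensor \<Rightarrow> tensor" where
  "map_otimes m n f g =
     lin_ext (m + n) (\<lambda>w. otimes (f (basis_tensor (take m w))) (g (basis_tensor (drop m w))))"

text \<open>id (x) f (x) id, with identities on the m-th and n-th tensor power and f defined on the
  k-th one.\<close>

definition pad :: "nat \<Rightarrow> nat \<Rightarrow> nat \<Rightarrow> (tensor \<Rightarrow> tensor) \<Rightarrow> tensor \<Rightarrow> tensor" where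
  "pad m k n f = map_otimes m (k + n) id (map_otimes k n f id)"

definition symmetrizer :: "nat \<Rightarrow> tensor \<Rightarrow> tensor" where
  "symmetrizer n =
     lin_ext n (\<lambda>w. tscale (1 / fact n)
       (\<Sum>\<sigma> | \<sigma> permutes {..<n}. basis_tensor (permute_list \<sigma> w)))"

definition sym_space :: "nat \<Rightarrow> tensor set" where
  "sym_space n = symmetrizer n ` tpower n"

definition cup :: "tensor \<Rightarrow> tensor" where
  "cup t = tscale (t [])
     (pure_tensor [axis 1 1, axis 2 1] - pure_tensor [axis 2 1, axis 1 1])"

text \<open>The determinant of the matrix with columns v and w.\<close>

definition det2 :: "complex^2 \<Rightarrow> complex^2 \<Rightarrow> complex" where
  "det2 v w = det (transpose (vector [v, w] :: complex^2^2))"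

definition cap :: "tensor \<Rightarrow> tensor" where
  "cap = lin_ext 2 (\<lambda>w. tscale (det2 (axis (w ! 0) 1) (axis (w ! 1) 1)) (pure_tensor []))"

fun cups :: "nat \<Rightarrow> tensor \<Rightarrow> tensor" where
  "cups 0 = id"
| "cups (Suc n) = pad n 0 n cup \<circ> cups n"

fun caps :: "nat \<Rightarrow> tensor \<Rightarrow> tensor" where
  "caps 0 = id"
| "caps (Suc n) = caps n \<circ> pad n 2 n cap"

definition mat_action :: "complex^2^2 \<Rightarrow> tensor \<Rightarrow> tensor" where
  "mat_action x = lin_ext 1 (\<lambda>w. pure_tensor [x *v axis (w ! 0) 1])"

fun action_power :: "nat \<Rightarrow> complex^2^2 \<Rightarrow> tensor \<Rightarrow> tensor" where
  "action_power 0 x = id"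
| "action_power (Suc n) x = map_otimes 1 n (mat_action x) (action_power n x)"


section \<open>Central functions\<close>

definition alpha :: "nat \<Rightarrow> nat \<Rightarrow> nat \<Rightarrow> real" where
  "alpha a b c = (- real a + real b + real c) / 2"

definition beta :: "nat \<Rightarrow> nat \<Rightarrow> nat \<Rightarrow> real" where
  "beta a b c = (real a - real b + real c) / 2"

definition gamma :: "nat \<Rightarrow> nat \<Rightarrow> nat \<Rightarrow> real" where
  "gamma a b c = (real a + real b - real c) / 2"

definition admissible :: "nat \<Rightarrow> nat \<Rightarrow> nat \<Rightarrow> bool" where
  "admissible a b c \<longleftrightarrow> alpha a b c \<in> \<nat> \<and> beta a b c \<in> \<nat> \<and> gamma a b c \<in> \<nat>"

text \<open>The conversions to \<open>nat\<close> are exact for admissible triples, the only ones of interest.\<close>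

definition iota :: "nat \<Rightarrow> nat \<Rightarrow> nat \<Rightarrow> tensor \<Rightarrow> tensor" where
  "iota a b c = map_otimes a b (symmetrizer a) (symmetrizer b) \<circ>
     pad (nat \<lfloor>beta a b c\<rfloor>) 0 (nat \<lfloor>alpha a b c\<rfloor>) (cups (nat \<lfloor>gamma a b c\<rfloor>))"

definition proj :: "nat \<Rightarrow> nat \<Rightarrow> nat \<Rightarrow> tensor \<Rightarrow> tensor" where
  "proj a b c = symmetrizer c \<circ>
     pad (nat \<lfloor>beta a b c\<rfloor>) (2 * nat \<lfloor>gamma a b c\<rfloor>) (nat \<lfloor>alpha a b c\<rfloor>)
       (caps (nat \<lfloor>gamma a b c\<rfloor>))"

text \<open>The trace of an endomorphism f of a finite-dimensional subspace W, computed in a basis of W;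
  by \<open>trace_on_eq\<close> below, the choice of basis does not matter.\<close>

definition trace_on :: "tensor set \<Rightarrow> (tensor \<Rightarrow> tensor) \<Rightarrow> complex" where
  "trace_on W f =
     (let B = (SOME B. B \<subseteq> W \<and> tsp.independent B \<and> tsp.span B = W)
      in \<Sum>b\<in>B. tsp.representation B (f b) b)"

definition SL2 :: "(complex^2^2) set" where
  "SL2 = {x. det x = 1}"

definition central_function ::
    "nat \<Rightarrow> nat \<Rightarrow> nat \<Rightarrow> complex^2^2 \<Rightarrow> complex^2^2 \<Rightarrow> complex" where
  "central_function a b c x1 x2 =
     trace_on (sym_space c)
       (proj a b c \<circ> map_otimes a b (action_power a x1) (action_power b x2) \<circ> iota a b c)"


section \<open>Polynomials in three variables\<close>

text \<open>A polynomial is the finitely supported family of its coefficients: the coefficient of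
  x^i y^j z^k is the value at the exponent (i, j, k).\<close>

type_synonym poly3 = "(nat \<times> nat \<times> nat) \<Rightarrow>\<^sub>0 complex"

definition poly3_monom :: "nat \<Rightarrow> nat \<Rightarrow> nat \<Rightarrow> poly3" where
  "poly3_monom i j k = Poly_Mapping.single (i, j, k) 1"

definition poly3_eval :: "poly3 \<Rightarrow> complex \<Rightarrow> complex \<Rightarrow> complex \<Rightarrow> complex" where
  "poly3_eval p x y z =
     (\<Sum>(i, j, k)\<in>Poly_Mapping.keys p. Poly_Mapping.lookup p (i, j, k) * x ^ i * y ^ j * z ^ k)"

text \<open>The zero polynomial has total degree less than every d, also for d = 0.\<close>

definition total_degree_less :: "poly3 \<Rightarrow> nat \<Rightarrow> bool" where
  "total_degree_less p d \<longleftrightarrow> (\<forall>(i, j, k)\<in>Poly_Mapping.keys p. i + j + k < d)"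

definition expressed_by :: "(complex^2^2 \<Rightarrow> complex^2^2 \<Rightarrow> complex) \<Rightarrow> poly3 \<Rightarrow> bool" where
  "expressed_by F p \<longleftrightarrow>
     (\<forall>x1\<in>SL2. \<forall>x2\<in>SL2.
        F x1 x2 = poly3_eval p (trace x1) (trace x2) (trace (x1 ** matrix_inv x2)))"


section \<open>The definitions on pure tensors, and independence of the basis\<close>

lemma tscale_apply: "tscale c t w = c * t w"
  by (simp add: tscale_def)

lemma sum_tensor_apply: "(\<Sum>i\<in>I. f i) w = (\<Sum>i\<in>I. f i w)" for f :: "'i \<Rightarrow> tensor"
  by (induction I rule: infinite_finite_induct) auto

lemma finite_words: "finite (words n)"
  using finite_lists_length_eq[of "UNIV :: 2 set" n] by (simp add: words_def)

lemma basis_tensor_apply: "basis_tensor w u = (if u = w then 1 else 0)"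
proof (cases "length u = length w")
  case True
  have "(\<Prod>i<length w. if w ! i = u ! i then 1 else 0 :: complex) = (if u = w then 1 else 0)"
    using True by (auto simp: list_eq_iff_nth_eq) (metis lessThan_iff)
  thus ?thesis
    using True by (simp add: basis_tensor_def pure_tensor_def axis_def eq_commute cong: if_cong)
qed (auto simp: basis_tensor_def pure_tensor_def)

lemma lin_ext_basis_tensor: "w \<in> words n \<Longrightarrow> lin_ext n F (basis_tensor w) = F w"
  by (rule ext) (simp add: lin_ext_def sum_tensor_apply tscale_apply basis_tensor_apply
      if_distrib[where f = "\<lambda>x. x * _"] finite_words cong: if_cong)

lemma tensor_expand: "t \<in> tpower n \<Longrightarrow> t = lin_ext n basis_tensor t"
  by (rule ext) (auto simp: lin_ext_def sum_tensor_apply tscale_apply basis_tensor_apply tpower_def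
      if_distrib[where f = "\<lambda>x. _ * x"] finite_words cong: if_cong)

lemma pure_tensor_append: "otimes (pure_tensor us) (pure_tensor vs) = pure_tensor (us @ vs)"
proof
  fix w :: "2 list"
  show "otimes (pure_tensor us) (pure_tensor vs) w = pure_tensor (us @ vs) w"
  proof (cases "length w = length us + length vs")
    case True
    have "otimes (pure_tensor us) (pure_tensor vs) w =
        (\<Sum>k\<in>{length us}. pure_tensor us (take k w) * pure_tensor vs (drop k w))"
      unfolding otimes_def
      by (rule sum.mono_neutral_right) (auto simp: True pure_tensor_def)
    also have "\<dots> = (\<Prod>i<length us. (us ! i) $ (w ! i)) *
        (\<Prod>i<length vs. (vs ! i) $ (w ! (length us + i)))"
      using True by (simp add: pure_tensor_def)
    also have "\<dots> = (\<Prod>i<length us + length vs. ((us @ vs) ! i) $ (w ! i))"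
    proof -
      have "(\<Prod>i<m + n. g i) = (\<Prod>i<m. g i) * (\<Prod>i<n. g (m + i))"
        for m n and g :: "nat \<Rightarrow> complex"
        by (induction n) (auto simp: mult.assoc)
      thus ?thesis by (simp add: nth_append)
    qed
    finally show ?thesis using True by (simp add: pure_tensor_def)
  next
    case False
    thus ?thesis
      by (auto simp: otimes_def pure_tensor_def intro!: sum.neutral)
  qed
qed

lemma symmetrizer_pure_tensor:
  assumes "length vs = n"
  shows "symmetrizer n (pure_tensor vs) =
    tscale (1 / fact n) (\<Sum>\<sigma> | \<sigma> permutes {..<n}. pure_tensor (permute_list \<sigma> vs))"
proof
  fix u :: "2 list"
  have *: "(\<Sum>w\<in>words n. pure_tensor vs w * basis_tensor (permute_list \<sigma> w) u) =
      pure_tensor (permute_list \<sigma> vs) u" if "\<sigma> permutes {..<n}" for \<sigma>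
  proof (cases "length u = n")
    case True
    have inv: "inv \<sigma> permutes {..<n}" using that by (rule permutes_inv)
    have eq: "u = permute_list \<sigma> w \<longleftrightarrow> w = permute_list (inv \<sigma>) u" if "length w = n" for w
    proof -
      have 1: "permute_list (inv \<sigma>) (permute_list \<sigma> w) = w"
        using permute_list_compose[of "inv \<sigma>" w \<sigma>] inv that permutes_inv_o(1)[OF \<open>\<sigma> permutes _\<close>]
        by simp
      have 2: "permute_list \<sigma> (permute_list (inv \<sigma>) u) = u"
        using permute_list_compose[of \<sigma> u "inv \<sigma>"] \<open>\<sigma> permutes _\<close> True
          permutes_inv_o(2)[OF \<open>\<sigma> permutes _\<close>] by simp
      show ?thesis using 1 2 by auto
    qed
    have "(\<Sum>w\<in>words n. pure_tensor vs w * basis_tensor (permute_list \<sigma> w) u) =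
        (\<Sum>w\<in>words n. if w = permute_list (inv \<sigma>) u then pure_tensor vs w else 0)"
      by (rule sum.cong) (auto simp: basis_tensor_apply words_def eq)
    also have "\<dots> = pure_tensor vs (permute_list (inv \<sigma>) u)"
      using True by (simp add: finite_words words_def[symmetric]) (simp add: words_def)
    also have "\<dots> = (\<Prod>i<n. (vs ! i) $ (u ! inv \<sigma> i))"
      using True assms inv by (simp add: pure_tensor_def permute_list_nth)
    also have "\<dots> = (\<Prod>i<n. (vs ! \<sigma> i) $ (u ! i))"
      using prod.permute[OF that, of "\<lambda>i. (vs ! i) $ (u ! inv \<sigma> i)"] permutes_inverses[OF that]
      by (simp add: o_def)
    also have "\<dots> = pure_tensor (permute_list \<sigma> vs) u"
      using True assms that by (simp add: pure_tensor_def permute_list_nth)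
    finally show ?thesis .
  next
    case False
    thus ?thesis using assms
      by (auto simp: basis_tensor_apply pure_tensor_def words_def intro!: sum.neutral)
  qed
  have "symmetrizer n (pure_tensor vs) u = 1 / fact n *
      (\<Sum>w\<in>words n. \<Sum>\<sigma> | \<sigma> permutes {..<n}. pure_tensor vs w * basis_tensor (permute_list \<sigma> w) u)"
    by (simp add: symmetrizer_def lin_ext_def sum_tensor_apply tscale_apply sum_distrib_left
        sum_divide_distrib mult_ac)
  also have "\<dots> = 1 / fact n * (\<Sum>\<sigma> | \<sigma> permutes {..<n}. pure_tensor (permute_list \<sigma> vs) u)"
    by (subst sum.swap) (simp add: *)
  finally show "symmetrizer n (pure_tensor vs) u = tscale (1 / fact n)
      (\<Sum>\<sigma> | \<sigma> permutes {..<n}. pure_tensor (permute_list \<sigma> vs)) u"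
    by (simp add: tscale_apply sum_tensor_apply)
qed

lemma words_1: "words (Suc 0) = {[1], [2]}"
proof -
  have "i = 1 \<or> i = 2" for i :: 2 using exhaust_2 .
  thus ?thesis by (auto simp: words_def length_Suc_conv)
qed

lemma words_2: "words 2 = {[1, 1], [1, 2], [2, 1], [2, 2]}"
proof -
  have "i = 1 \<or> i = 2" for i :: 2 using exhaust_2 .
  thus ?thesis by (auto simp: words_def length_Suc_conv numeral_2_eq_2)
qed

lemma cap_pure_tensor: "cap (pure_tensor [v, w]) = tscale (det2 v w) (pure_tensor [])"
  by (rule ext)
    (simp add: cap_def lin_ext_def words_2 tscale_apply pure_tensor_def det2_def
      det_2 transpose_def vector_2 axis_def lessThan_Suc algebra_simps)

lemma mat_action_pure_tensor: "mat_action x (pure_tensor [v]) = pure_tensor [x *v v]"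
proof
  fix w :: "2 list"
  show "mat_action x (pure_tensor [v]) w = pure_tensor [x *v v] w"
    by (auto simp: mat_action_def lin_ext_def words_1 tscale_apply pure_tensor_def
        matrix_vector_mult_def sum_2 axis_def)
qed

lemma map_otimes_otimes:
  assumes f: "Vector_Spaces.linear tscale tscale f" and g: "Vector_Spaces.linear tscale tscale g"
    and s: "s \<in> tpower m" and t: "t \<in> tpower n"
  shows "map_otimes m n f g (otimes s t) = otimes (f s) (g t)"
proof
  fix x :: "2 list"
  interpret f: Vector_Spaces.linear tscale tscale f by fact
  interpret g: Vector_Spaces.linear tscale tscale g by fact
  have fs: "f s = (\<Sum>u\<in>words m. tscale (s u) (f (basis_tensor u)))"
    by (subst tensor_expand[OF s]) (simp add: lin_ext_def f.sum f.scale)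
  have gt: "g t = (\<Sum>v\<in>words n. tscale (t v) (g (basis_tensor v)))"
    by (subst tensor_expand[OF t]) (simp add: lin_ext_def g.sum g.scale)
  have st: "otimes s t (u @ v) = s u * t v" if "u \<in> words m" "v \<in> words n" for u v
  proof -
    have "otimes s t (u @ v) = (\<Sum>k\<in>{m}. s (take k (u @ v)) * t (drop k (u @ v)))"
      unfolding otimes_def
      by (rule sum.mono_neutral_right) (use s that in \<open>auto simp: tpower_def words_def\<close>)
    thus ?thesis using that by (simp add: words_def)
  qed
  have bij: "bij_betw (\<lambda>(u, v). u @ v) (words m \<times> words n) (words (m + n))"
    by (rule bij_betw_byWitness[where f' = "\<lambda>w. (take m w, drop m w)"]) (auto simp: words_def)
  have "map_otimes m n f g (otimes s t) x = (\<Sum>w\<in>words (m + n). otimes s t w *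
      otimes (f (basis_tensor (take m w))) (g (basis_tensor (drop m w))) x)"
    by (simp add: map_otimes_def lin_ext_def sum_tensor_apply tscale_apply)
  also have "\<dots> = (\<Sum>(u, v)\<in>words m \<times> words n. s u * t v *
      otimes (f (basis_tensor u)) (g (basis_tensor v)) x)"
    by (subst sum.reindex_bij_betw[OF bij, symmetric], rule sum.cong)
      (auto simp: st, auto simp: words_def)
  also have "\<dots> = (\<Sum>p\<in>words m \<times> words n. \<Sum>k\<le>length x. (s (fst p) * f (basis_tensor (fst p)) (take k x)) *
      (t (snd p) * g (basis_tensor (snd p)) (drop k x)))"
    by (rule sum.cong) (auto simp: otimes_def sum_distrib_left mult_ac)
  also have "\<dots> = (\<Sum>k\<le>length x. \<Sum>p\<in>words m \<times> words n. (s (fst p) * f (basis_tensor (fst p)) (take k x)) *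
      (t (snd p) * g (basis_tensor (snd p)) (drop k x)))"
    by (rule sum.swap)
  also have "\<dots> = otimes (f s) (g t) x"
    unfolding fs gt otimes_def sum_tensor_apply tscale_apply sum_product sum.cartesian_product
    by (simp add: case_prod_unfold)
  finally show "map_otimes m n f g (otimes s t) x = otimes (f s) (g t) x" .
qed

lemma trace_on_eq:
  assumes B: "finite B" "B \<subseteq> W" "tsp.independent B" "tsp.span B = W"
    and f: "Vector_Spaces.linear tscale tscale f" "f ` W \<subseteq> W"
  shows "trace_on W f = (\<Sum>b\<in>B. tsp.representation B (f b) b)"
proof -
  define C where "C = (SOME B. B \<subseteq> W \<and> tsp.independent B \<and> tsp.span B = W)"
  have C: "C \<subseteq> W" "tsp.independent C" "tsp.span C = W"
    using someI[of "\<lambda>B. B \<subseteq> W \<and> tsp.independent B \<and> tsp.span B = W" B] B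
    unfolding C_def by auto
  have fC: "finite C"
    using tsp.independent_span_bound[of B C] B C by auto
  interpret f: Vector_Spaces.linear tscale tscale f by fact
  have expand: "v = (\<Sum>d\<in>D. tscale (tsp.representation D v d) d)"
    if "finite D" "tsp.independent D" "tsp.span D = W" "v \<in> W" for D v
    using tsp.sum_representation_eq[of D v D] that by auto
  have rep: "tsp.representation D (\<Sum>i\<in>I. tscale (g i) (h i)) d =
      (\<Sum>i\<in>I. g i * tsp.representation D (h i) d)"
    if "tsp.independent D" "tsp.span D = W" "\<And>i. i \<in> I \<Longrightarrow> h i \<in> W" for D I g h d
    using that by (subst tsp.representation_sum)
      (auto simp: tsp.representation_scale tsp.span_scale)
  have fW: "v \<in> W \<Longrightarrow> f v \<in> W" for v using f(2) by auto
  have inC: "b \<in> W" if "b \<in> B" for b using that B by auto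
  have inW: "c \<in> W" if "c \<in> C" for c using that C by auto
  have "(\<Sum>b\<in>B. tsp.representation B (f b) b) =
      (\<Sum>b\<in>B. tsp.representation B
        (\<Sum>c\<in>C. tscale (tsp.representation C b c) (f c)) b)"
  proof (rule sum.cong)
    fix b assume "b \<in> B"
    hence "f b = f (\<Sum>c\<in>C. tscale (tsp.representation C b c) c)"
      using expand[of C b] fC C inC by simp
    also have "\<dots> = (\<Sum>c\<in>C. tscale (tsp.representation C b c) (f c))"
      by (simp add: f.sum f.scale)
    finally show "tsp.representation B (f b) b = tsp.representation B
        (\<Sum>c\<in>C. tscale (tsp.representation C b c) (f c)) b" by simp
  qed simp
  also have "\<dots> = (\<Sum>b\<in>B. \<Sum>c\<in>C. tsp.representation C b c * tsp.representation B (f c) b)"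
    by (intro sum.cong refl rep) (use B fW inW in auto)
  also have "\<dots> = (\<Sum>c\<in>C. \<Sum>b\<in>B. tsp.representation B (f c) b * tsp.representation C b c)"
    by (subst sum.swap) (simp add: mult.commute)
  also have "\<dots> = (\<Sum>c\<in>C. tsp.representation C
      (\<Sum>b\<in>B. tscale (tsp.representation B (f c) b) b) c)"
    by (intro sum.cong refl rep[symmetric]) (use C inC in auto)
  also have "\<dots> = (\<Sum>c\<in>C. tsp.representation C (f c) c)"
    using expand[of B] B fW inW by (intro sum.cong) auto
  finally show ?thesis
    by (simp add: trace_on_def C_def[symmetric] Let_def)
qed

end

theory Submission
  imports Defs
begin

text \<open>
  The central function is a trace, and both parts of the claim are read off from its expansion
  in the standard basis of the tensor powers (\<open>central_function_state_sum\<close>): a finite sum of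
  constants times products of entries of \<open>x1\<close> and \<open>x2\<close>.

  Existence of the polynomial. The symmetrizers, cups and caps commute with the action of
  \<open>SL(2, C)\<close>, so the central function is invariant under simultaneous conjugation
  (\<open>central_function_conjugation\<close>). If \<open>v\<close> is an eigenvector of \<open>x2\<close> with eigenvalue \<open>p\<close> which is
  not an eigenvector of \<open>x1\<close>, then the pair is conjugate to a normal form whose entries are
  polynomials in \<open>p\<close>, \<open>1 / p\<close>, \<open>x\<close> and \<open>z\<close> (\<open>slice_conj\<close>). Since \<open>p\<close> satisfies the quadratic
  equation \<open>p\<^sup>2 = y p - 1\<close> with \<open>y = p + 1 / p\<close>, the central function takes the form
  \<open>A(x, y, z) + p B(x, y, z)\<close> with polynomials \<open>A\<close> and \<open>B\<close>. The eigenvalue \<open>1 / p\<close> gives the same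
  value \<open>A + B / p\<close>; so \<open>B\<close> vanishes at \<open>(x, y, z)\<close> if \<open>p\<close> and \<open>1 / p\<close> differ and both
  eigenvectors are of this kind. Thus \<open>A\<close> expresses the central function on generic pairs, and by
  continuity on all pairs (\<open>central_function_poly_function\<close>). It is the only such polynomial
  because the normal forms realize every triple \<open>(x, y, z)\<close>.

  Leading monomial. Along a curve of pairs, with parameter \<open>\<nu> \<rightarrow> 0\<close>, on which \<open>x\<close>, \<open>y\<close>, \<open>z\<close> grow
  like \<open>\<xi> / \<nu>\<^sup>2\<close>, \<open>\<eta> / \<nu>\<^sup>2\<close>, \<open>\<zeta> / \<nu>\<^sup>2\<close>, a polynomial of degree \<open>d\<close> grows like \<open>\<nu>\<close> to the power \<open>-2 d\<close>
  times its top homogeneous part at \<open>(\<xi>, \<eta>, \<zeta>)\<close>. On the curve chosen here the growth of an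
  entry of \<open>x1\<close> or \<open>x2\<close> is bounded by a power of \<open>\<nu>\<close> whose exponent is a sum of a contribution of
  its row and one of its column. The bound for a term of the state sum then depends only on how often
  the index \<open>2\<close> occurs in the words that label it, a number which permutations preserve and cups and
  caps control. Exactly one term reaches the maximal order of growth, and it contributes
  \<open>\<xi> ^ \<beta> * \<eta> ^ \<alpha> * \<zeta> ^ \<gamma>\<close> (\<open>central_function_leading_term\<close>). Hence the difference of the polynomial
  and \<open>x ^ \<beta> * y ^ \<alpha> * z ^ \<gamma>\<close> has no homogeneous part of degree \<open>\<alpha> + \<beta> + \<gamma>\<close> or more
  (\<open>total_degree_less_if_tendsto\<close>).
\<close>

section \<open>Linear maps between tensor powers\<close>

abbreviation lin :: "(tensor \<Rightarrow> tensor) \<Rightarrow> bool" where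
  "lin \<equiv> Vector_Spaces.linear tscale tscale"

lemma lin_iff: "lin f \<longleftrightarrow> (\<forall>s t. f (s + t) = f s + f t) \<and> (\<forall>c t. f (tscale c t) = tscale c (f t))"
  unfolding Vector_Spaces.linear_iff using tsp.vector_space_axioms by blast

lemma lin_id: "lin id"
  by (simp add: lin_iff)

lemma lin_comp: "lin f \<Longrightarrow> lin g \<Longrightarrow> lin (g \<circ> f)"
  by (simp add: lin_iff)

lemma lin_ext_apply: "lin_ext n F t v = (\<Sum>w\<in>words n. t w * F w v)"
  by (simp add: lin_ext_def sum_tensor_apply tscale_apply)

lemma lin_lin_ext: "lin (lin_ext n F)"
  by (simp add: lin_iff fun_eq_iff lin_ext_apply tscale_apply sum.distrib sum_distrib_left
      algebra_simps)

lemma lin_map_otimes: "lin (map_otimes m n f g)"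
  by (simp add: map_otimes_def lin_lin_ext)

lemma lin_pad: "lin (pad m k n f)"
  by (simp add: pad_def lin_map_otimes)

lemma lin_symmetrizer: "lin (symmetrizer n)"
  by (simp add: symmetrizer_def lin_lin_ext)

lemma lin_cup: "lin cup"
  by (simp add: lin_iff cup_def fun_eq_iff tscale_apply algebra_simps)

lemma lin_cap: "lin cap"
  by (simp add: cap_def lin_lin_ext)

lemma lin_caps: "lin (caps n)"
  by (induction n) (simp_all only: caps.simps lin_id lin_comp lin_pad)

lemma lin_action_power: "lin (action_power n x)"
  by (cases n) (simp_all only: action_power.simps lin_id lin_map_otimes)

lemma lin_expand:
  assumes "lin f" "t \<in> tpower n"
  shows "f t = (\<Sum>w\<in>words n. tscale (t w) (f (basis_tensor w)))"
proof -
  interpret f: Vector_Spaces.linear tscale tscale f by fact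
  show ?thesis
    by (subst tensor_expand[OF assms(2)]) (simp add: lin_ext_def f.sum f.scale)
qed

lemma lin_expand_apply:
  assumes "lin f" "t \<in> tpower n"
  shows "f t v = (\<Sum>w\<in>words n. t w * f (basis_tensor w) v)"
  by (simp add: lin_expand[OF assms] sum_tensor_apply tscale_apply)

lemma lin_eqI:
  assumes "lin f" "lin g" "\<And>w. w \<in> words n \<Longrightarrow> f (basis_tensor w) = g (basis_tensor w)"
    and "t \<in> tpower n"
  shows "f t = g t"
  using assms by (simp add: lin_expand[where n = n])

lemma tpower_sum: "(\<And>i. i \<in> I \<Longrightarrow> f i \<in> tpower n) \<Longrightarrow> (\<Sum>i\<in>I. f i) \<in> tpower n"
  by (auto simp: tpower_def sum_tensor_apply)

lemma tpower_tscale: "t \<in> tpower n \<Longrightarrow> tscale c t \<in> tpower n"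
  by (auto simp: tpower_def tscale_apply)

lemma tpower_diff: "s \<in> tpower n \<Longrightarrow> t \<in> tpower n \<Longrightarrow> s - t \<in> tpower n"
  by (auto simp: tpower_def)

lemma pure_tensor_tpower: "length vs = n \<Longrightarrow> pure_tensor vs \<in> tpower n"
  by (auto simp: tpower_def pure_tensor_def words_def)

lemma basis_tensor_tpower: "length w = n \<Longrightarrow> basis_tensor w \<in> tpower n"
  by (simp add: basis_tensor_def pure_tensor_tpower)

lemma basis_tensor_append: "basis_tensor (u @ v) = otimes (basis_tensor u) (basis_tensor v)"
  by (simp add: basis_tensor_def pure_tensor_append)

lemma lin_tpower:
  assumes "lin f" "\<And>w. length w = m \<Longrightarrow> f (basis_tensor w) \<in> tpower n" "t \<in> tpower m"
  shows "f t \<in> tpower n"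
  unfolding lin_expand[OF assms(1,3)]
  by (intro tpower_sum tpower_tscale assms(2)) (auto simp: words_def)

lemma otimes_apply:
  assumes "s \<in> tpower m" "t \<in> tpower n"
  shows "otimes s t w = (if length w = m + n then s (take m w) * t (drop m w) else 0)"
proof -
  have *: "s (take k w) * t (drop k w) = 0" if "k \<le> length w" "k \<noteq> m \<or> length w \<noteq> m + n" for k
  proof (cases "length (take k w) = m")
    case True
    hence "length (drop k w) \<noteq> n" using that by auto
    thus ?thesis using assms(2) by (simp add: tpower_def words_def)
  qed (use assms(1) in \<open>simp add: tpower_def words_def\<close>)
  show ?thesis
  proof (cases "length w = m + n")
    case True
    have "otimes s t w = (\<Sum>k\<in>{m}. s (take k w) * t (drop k w))"
      unfolding otimes_def using True * by (intro sum.mono_neutral_right) auto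
    thus ?thesis using True by simp
  qed (auto simp: otimes_def * intro!: sum.neutral)
qed

lemma otimes_tpower: "s \<in> tpower m \<Longrightarrow> t \<in> tpower n \<Longrightarrow> otimes s t \<in> tpower (m + n)"
  by (auto simp: tpower_def[of "m + n"] words_def otimes_apply)

lemma map_otimes_basis_tensor:
  "length w = m + n \<Longrightarrow> map_otimes m n f g (basis_tensor w) =
    otimes (f (basis_tensor (take m w))) (g (basis_tensor (drop m w)))"
  by (simp add: map_otimes_def lin_ext_basis_tensor words_def)

lemma map_otimes_tpower:
  assumes "\<And>t. t \<in> tpower m \<Longrightarrow> f t \<in> tpower m'" "\<And>t. t \<in> tpower n \<Longrightarrow> g t \<in> tpower n'"
    and "t \<in> tpower (m + n)"
  shows "map_otimes m n f g t \<in> tpower (m' + n')"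
  by (rule lin_tpower[OF lin_map_otimes _ assms(3)])
    (simp add: map_otimes_basis_tensor assms otimes_tpower basis_tensor_tpower)

lemma pad_basis_tensor:
  assumes "length w = m + (k + n)"
  shows "pad m k n f (basis_tensor w) = otimes (basis_tensor (take m w))
    (otimes (f (basis_tensor (take k (drop m w)))) (basis_tensor (drop (m + k) w)))"
  using assms by (simp add: pad_def map_otimes_basis_tensor add.commute)

lemma pad_tpower:
  assumes "\<And>t. t \<in> tpower k \<Longrightarrow> f t \<in> tpower k'" "t \<in> tpower (m + (k + n))"
  shows "pad m k n f t \<in> tpower (m + (k' + n))"
  unfolding pad_def using assms by (intro map_otimes_tpower) auto

lemma symmetrizer_tpower: "symmetrizer n t \<in> tpower n"
  unfolding symmetrizer_def lin_ext_def
  by (intro tpower_sum tpower_tscale basis_tensor_tpower) (auto simp: words_def)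

lemma cup_tpower: "cup t \<in> tpower 2"
  unfolding cup_def by (intro tpower_tscale tpower_diff pure_tensor_tpower) auto

lemma cap_tpower: "cap t \<in> tpower 0"
  unfolding cap_def lin_ext_def by (intro tpower_sum tpower_tscale pure_tensor_tpower) auto

lemma cups_tpower: "t \<in> tpower 0 \<Longrightarrow> cups n t \<in> tpower (2 * n)"
proof (induction n)
  case (Suc n)
  have "pad n 0 n cup (cups n t) \<in> tpower (n + (2 + n))"
    by (rule pad_tpower) (use Suc in \<open>auto simp: cup_tpower mult_2\<close>)
  moreover have "n + (2 + n) = 2 * Suc n" by simp
  ultimately show ?case by (simp del: mult_Suc_right)
qed auto

lemma caps_tpower: "t \<in> tpower (2 * n) \<Longrightarrow> caps n t \<in> tpower 0"
proof (induction n arbitrary: t)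
  case (Suc n)
  have "n + (2 + n) = 2 * Suc n" by simp
  hence "t \<in> tpower (n + (2 + n))" using Suc.prems by metis
  hence "pad n 2 n cap t \<in> tpower (n + (0 + n))"
    by (intro pad_tpower cap_tpower)
  thus ?case using Suc.IH by (simp add: mult_2)
qed auto

lemma action_power_pure_tensor:
  "length vs = n \<Longrightarrow> action_power n x (pure_tensor vs) = pure_tensor (map ((*v) x) vs)"
proof (induction n arbitrary: vs)
  case (Suc n)
  then obtain v us where vs: "vs = v # us" "length us = n" by (cases vs) auto
  have "action_power (Suc n) x (pure_tensor vs) =
      map_otimes 1 n (mat_action x) (action_power n x) (otimes (pure_tensor [v]) (pure_tensor us))"
    by (simp add: vs pure_tensor_append)
  also have "\<dots> = otimes (mat_action x (pure_tensor [v])) (action_power n x (pure_tensor us))"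
    by (rule map_otimes_otimes)
      (auto simp: mat_action_def lin_lin_ext lin_action_power vs intro!: pure_tensor_tpower)
  also have "\<dots> = pure_tensor (map ((*v) x) vs)"
    by (simp add: mat_action_pure_tensor Suc.IH vs pure_tensor_append)
  finally show ?case .
qed auto

lemma action_power_tpower: "t \<in> tpower n \<Longrightarrow> action_power n x t \<in> tpower n"
  by (rule lin_tpower[OF lin_action_power])
    (auto simp: basis_tensor_def action_power_pure_tensor intro!: pure_tensor_tpower)

lemma action_power_basis_tensor:
  assumes "length r = n"
  shows "action_power n x (basis_tensor r) t =
    (if length t = n then \<Prod>i<n. x $ (t ! i) $ (r ! i) else 0)"
proof -
  have "action_power n x (basis_tensor r) = pure_tensor (map (\<lambda>i. x *v axis i 1) r)"
    using assms by (simp add: basis_tensor_def action_power_pure_tensor comp_def)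
  moreover have "(x *v axis j 1) $ i = x $ i $ j" for i j
    by (simp add: matrix_vector_mult_def axis_def if_distrib[where f = "\<lambda>y. _ * y"] cong: if_cong)
  ultimately show ?thesis using assms by (simp add: pure_tensor_def)
qed

lemma action_power_otimes:
  assumes "s \<in> tpower m" "t \<in> tpower n"
  shows "action_power (m + n) x (otimes s t) = otimes (action_power m x s) (action_power n x t)"
proof -
  have "action_power (m + n) x (otimes s t) =
      map_otimes m n (action_power m x) (action_power n x) (otimes s t)"
  proof (rule lin_eqI[OF lin_action_power lin_map_otimes _ otimes_tpower[OF assms]])
    fix w :: "2 list" assume w: "w \<in> words (m + n)"
    let ?e = "map (\<lambda>i. axis i 1) :: 2 list \<Rightarrow> (complex^2) list"
    have *: "map ((*v) x) (?e w) = map ((*v) x) (?e (take m w)) @ map ((*v) x) (?e (drop m w))"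
      by (simp flip: map_append)
    have "action_power (m + n) x (basis_tensor w) = pure_tensor (map ((*v) x) (?e w))"
      using w unfolding basis_tensor_def words_def by (intro action_power_pure_tensor) simp
    also have "\<dots> = otimes (pure_tensor (map ((*v) x) (?e (take m w))))
        (pure_tensor (map ((*v) x) (?e (drop m w))))"
      unfolding * pure_tensor_append ..
    also have "\<dots> = otimes (action_power m x (basis_tensor (take m w)))
        (action_power n x (basis_tensor (drop m w)))"
      using w unfolding basis_tensor_def words_def
      by (subst (1 2) action_power_pure_tensor) simp_all
    finally show "action_power (m + n) x (basis_tensor w) =
        map_otimes m n (action_power m x) (action_power n x) (basis_tensor w)"
      using w by (simp add: map_otimes_basis_tensor words_def)
  qed
  also have "\<dots> = otimes (action_power m x s) (action_power n x t)"
    by (rule map_otimes_otimes) (use assms lin_action_power in auto)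
  finally show ?thesis .
qed

section \<open>Conjugation invariance\<close>

text \<open>
  Equivariance under the action of \<open>g\<close>, in a form with two maps \<open>f\<close> and \<open>f'\<close>: for the action of a
  matrix \<open>x\<close>, the second map is the action of the conjugate of \<open>x\<close> by \<open>g\<close>. This lets one relation
  cover all maps from which the central function is composed.
\<close>

definition intertwines ::
    "complex^2^2 \<Rightarrow> nat \<Rightarrow> nat \<Rightarrow> (tensor \<Rightarrow> tensor) \<Rightarrow> (tensor \<Rightarrow> tensor) \<Rightarrow> bool" where
  "intertwines g m n f f' \<longleftrightarrow> lin f \<and> lin f' \<and>
     (\<forall>t\<in>tpower m. f t \<in> tpower n \<and> f' (action_power m g t) = action_power n g (f t))"

lemma intertwinesI:
  assumes "lin f" "lin f'"
    and "\<And>w. length w = m \<Longrightarrow> f (basis_tensor w) \<in> tpower n \<and>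
      f' (action_power m g (basis_tensor w)) = action_power n g (f (basis_tensor w))"
  shows "intertwines g m n f f'"
proof -
  have "(f' \<circ> action_power m g) t = (action_power n g \<circ> f) t" if "t \<in> tpower m" for t
    by (rule lin_eqI[OF _ _ _ that])
      (use assms in \<open>auto simp: words_def intro!: lin_comp lin_action_power simp del: o_apply, auto\<close>)
  thus ?thesis using assms lin_tpower[OF assms(1), of m n] by (auto simp: intertwines_def)
qed

lemma intertwines_id: "intertwines g n n id id"
  by (simp add: intertwines_def lin_id)

lemma intertwines_comp:
  "intertwines g m n f f' \<Longrightarrow> intertwines g n k h h' \<Longrightarrow> intertwines g m k (h \<circ> f) (h' \<circ> f')"
  by (auto simp: intertwines_def intro: lin_comp)

lemma intertwines_map_otimes:
  assumes f: "intertwines g m m' f f'" and h: "intertwines g n n' h h'"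
  shows "intertwines g (m + n) (m' + n') (map_otimes m n f h) (map_otimes m n f' h')"
proof (rule intertwinesI[OF lin_map_otimes lin_map_otimes])
  fix w :: "2 list" assume w: "length w = m + n"
  let ?u = "basis_tensor (take m w)" and ?v = "basis_tensor (drop m w)"
  have uv: "?u \<in> tpower m" "?v \<in> tpower n"
    using w by (auto intro: basis_tensor_tpower)
  have fu: "f ?u \<in> tpower m'" and hv: "h ?v \<in> tpower n'"
    using f h uv by (auto simp: intertwines_def)
  have "map_otimes m n f' h' (action_power (m + n) g (otimes ?u ?v)) =
      otimes (f' (action_power m g ?u)) (h' (action_power n g ?v))"
    unfolding action_power_otimes[OF uv]
    by (rule map_otimes_otimes) (use f h uv in \<open>auto simp: intertwines_def action_power_tpower\<close>)
  also have "\<dots> = action_power (m' + n') g (otimes (f ?u) (h ?v))"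
    using f h uv fu hv by (simp add: action_power_otimes intertwines_def)
  finally show "map_otimes m n f h (basis_tensor w) \<in> tpower (m' + n') \<and>
      map_otimes m n f' h' (action_power (m + n) g (basis_tensor w)) =
      action_power (m' + n') g (map_otimes m n f h (basis_tensor w))"
    using w by (simp add: map_otimes_basis_tensor otimes_tpower fu hv flip: basis_tensor_append)
qed

lemma intertwines_pad:
  "intertwines g k k' f f' \<Longrightarrow>
    intertwines g (m + (k + n)) (m + (k' + n)) (pad m k n f) (pad m k n f')"
  unfolding pad_def by (intro intertwines_map_otimes intertwines_id)

lemma length_2_cases:
  assumes "length (w :: 2 list) = 2"
  obtains "w = [1, 1]" | "w = [1, 2]" | "w = [2, 1]" | "w = [2, 2]"
  using assms words_2 by (auto simp: words_def set_eq_iff)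

lemma det2_eq: "det2 v w = v $ 1 * w $ 2 - w $ 1 * v $ 2"
  by (simp add: det2_def det_2 transpose_def vector_2)

lemma det2_mult: "det2 (g *v v) (g *v w) = det g * det2 v w"
  by (simp add: det2_eq det_2 matrix_vector_mult_def sum_2 algebra_simps)

text \<open>
  The tensor \<open>e\<^sub>1 \<otimes> e\<^sub>2 - e\<^sub>2 \<otimes> e\<^sub>1\<close> spans the antisymmetric part of \<open>V \<otimes> V\<close>, on which \<open>g\<close> acts by
  its determinant.
\<close>

lemma intertwines_cup:
  assumes "det g = 1"
  shows "intertwines g 0 2 cup cup"
proof (rule intertwinesI[OF lin_cup lin_cup])
  fix w :: "2 list" assume "length w = 0"
  hence cup: "cup (basis_tensor w) =
      pure_tensor [axis 1 1, axis 2 1] - pure_tensor [axis 2 1, axis 1 1]"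
    by (simp add: cup_def basis_tensor_apply tscale_def fun_eq_iff)
  interpret a: Vector_Spaces.linear tscale tscale "action_power 2 g" by (rule lin_action_power)
  have "action_power 2 g (cup (basis_tensor w)) =
      pure_tensor [g *v axis 1 1, g *v axis 2 1] - pure_tensor [g *v axis 2 1, g *v axis 1 1]"
    unfolding cup a.diff by (subst (1 2) action_power_pure_tensor) simp_all
  also have "\<dots> = cup (basis_tensor w)"
  proof
    fix u :: "2 list"
    show "(pure_tensor [g *v axis 1 1, g *v axis 2 1] -
      pure_tensor [g *v axis 2 1, g *v axis 1 1]) u = cup (basis_tensor w) u"
    proof (cases "length u = 2")
      case True
      thus ?thesis using assms
        by (elim length_2_cases) (simp_all add: cup pure_tensor_def lessThan_Suc
            numeral_2_eq_2 matrix_vector_mult_def sum_2 axis_def det_2 algebra_simps)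
    qed (simp add: cup pure_tensor_def)
  qed
  finally show "cup (basis_tensor w) \<in> tpower 2 \<and>
      cup (action_power 0 g (basis_tensor w)) = action_power 2 g (cup (basis_tensor w))"
    by (simp add: cup_tpower)
qed

lemma intertwines_cap:
  assumes "det g = 1"
  shows "intertwines g 2 0 cap cap"
proof (rule intertwinesI[OF lin_cap lin_cap])
  fix w :: "2 list" assume w: "length w = 2"
  then obtain i j where ij: "w = [i, j]" by (auto simp: length_Suc_conv numeral_2_eq_2)
  show "cap (basis_tensor w) \<in> tpower 0 \<and>
      cap (action_power 2 g (basis_tensor w)) = action_power 0 g (cap (basis_tensor w))"
    using cap_tpower[of "basis_tensor w"]
    by (simp add: ij basis_tensor_def action_power_pure_tensor cap_pure_tensor
        det2_mult assms)
qed

lemma intertwines_cups: "det g = 1 \<Longrightarrow> intertwines g 0 (2 * n) (cups n) (cups n)"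
proof (induction n)
  case (Suc n)
  have "intertwines g (n + (0 + n)) (n + (2 + n)) (pad n 0 n cup) (pad n 0 n cup)"
    by (intro intertwines_pad intertwines_cup Suc.prems)
  moreover have "n + (0 + n) = 2 * n" "n + (2 + n) = 2 * Suc n" by simp_all
  ultimately show ?case using Suc by (simp only: cups.simps) (rule intertwines_comp, simp)
qed (simp add: intertwines_id)

lemma intertwines_caps: "det g = 1 \<Longrightarrow> intertwines g (2 * n) 0 (caps n) (caps n)"
proof (induction n)
  case (Suc n)
  have "intertwines g (n + (2 + n)) (n + (0 + n)) (pad n 2 n cap) (pad n 2 n cap)"
    by (intro intertwines_pad intertwines_cap Suc.prems)
  moreover have "n + (0 + n) = 2 * n" "n + (2 + n) = 2 * Suc n" by simp_all
  ultimately show ?case using Suc by (simp only: caps.simps) (rule intertwines_comp, simp_all)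
qed (simp add: intertwines_id)

lemma intertwines_symmetrizer: "intertwines g n n (symmetrizer n) (symmetrizer n)"
proof (rule intertwinesI[OF lin_symmetrizer lin_symmetrizer])
  fix w :: "2 list" assume w: "length w = n"
  interpret a: Vector_Spaces.linear tscale tscale "action_power n g" by (rule lin_action_power)
  let ?e = "map (\<lambda>i. axis i 1) w :: (complex^2) list"
  have "action_power n g (symmetrizer n (pure_tensor ?e)) =
      tscale (1 / fact n) (\<Sum>\<sigma> | \<sigma> permutes {..<n}.
        pure_tensor (map ((*v) g) (permute_list \<sigma> ?e)))"
    using w by (simp add: symmetrizer_pure_tensor a.scale a.sum action_power_pure_tensor)
  also have "\<dots> = symmetrizer n (pure_tensor (map ((*v) g) ?e))"
    using w by (subst symmetrizer_pure_tensor) (simp, intro arg_cong[where f = "tscale _"] sum.cong,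
        simp_all add: permute_list_map comp_def)
  also have "\<dots> = symmetrizer n (action_power n g (pure_tensor ?e))"
    using w by (simp add: action_power_pure_tensor)
  finally show "symmetrizer n (basis_tensor w) \<in> tpower n \<and>
      symmetrizer n (action_power n g (basis_tensor w)) =
      action_power n g (symmetrizer n (basis_tensor w))"
    by (simp add: symmetrizer_tpower basis_tensor_def)
qed

lemma intertwines_action_power:
  assumes "y ** g = g ** x"
  shows "intertwines g n n (action_power n x) (action_power n y)"
proof (rule intertwinesI[OF lin_action_power lin_action_power])
  fix w :: "2 list" assume w: "length w = n"
  have "y *v (g *v v) = g *v (x *v v)" for v
    by (simp add: matrix_vector_mul_assoc assms)
  thus "action_power n x (basis_tensor w) \<in> tpower n \<and>
      action_power n y (action_power n g (basis_tensor w)) =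
      action_power n g (action_power n x (basis_tensor w))"
    using w by (simp add: basis_tensor_def action_power_tpower action_power_pure_tensor
        pure_tensor_tpower comp_def)
qed

definition word_trace :: "nat \<Rightarrow> (tensor \<Rightarrow> tensor) \<Rightarrow> complex" where
  "word_trace n f = (\<Sum>w\<in>words n. f (basis_tensor w) w)"

lemma word_trace_comp_commute:
  assumes "lin f" "lin h" "\<And>t. t \<in> tpower n \<Longrightarrow> f t \<in> tpower n" "\<And>t. t \<in> tpower n \<Longrightarrow> h t \<in> tpower n"
  shows "word_trace n (f \<circ> h) = word_trace n (h \<circ> f)"
proof -
  have *: "word_trace n (f \<circ> h) =
      (\<Sum>w\<in>words n. \<Sum>v\<in>words n. h (basis_tensor w) v * f (basis_tensor v) w)"
    if "lin f" "\<And>t. t \<in> tpower n \<Longrightarrow> h t \<in> tpower n" for f h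
    unfolding word_trace_def
  proof (rule sum.cong)
    fix w assume "w \<in> words n"
    hence "h (basis_tensor w) \<in> tpower n"
      by (intro that(2) basis_tensor_tpower) (simp add: words_def)
    thus "(f \<circ> h) (basis_tensor w) w =
        (\<Sum>v\<in>words n. h (basis_tensor w) v * f (basis_tensor v) w)"
      by (simp add: lin_expand_apply[OF that(1)])
  qed simp
  show ?thesis
    by (subst (1 2) *, use assms in simp_all) (subst sum.swap, simp add: mult.commute)
qed

text \<open>
  A map with values in \<open>W\<close> induces zero on the quotient by \<open>W\<close>, so that its trace on the whole
  tensor power is the trace of its restriction to \<open>W\<close>. Hence the trace on the symmetric tensors can be computed in the
  basis of words, in which all maps involved have explicit entries.
\<close>

lemma trace_on_eq_word_trace:
  assumes W: "tsp.subspace W" "W \<subseteq> tpower n"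
    and f: "lin f" "\<And>t. t \<in> tpower n \<Longrightarrow> f t \<in> W"
  shows "trace_on W f = word_trace n f"
proof -
  define C where "C = (SOME B. B \<subseteq> W \<and> tsp.independent B \<and> tsp.span B = W)"
  obtain B where "B \<subseteq> W" "tsp.independent B" "W \<subseteq> tsp.span B"
    using tsp.basis_exists[of W] by metis
  moreover from this have "tsp.span B \<subseteq> W" using W by (intro tsp.span_minimal)
  ultimately have C: "C \<subseteq> W" "tsp.independent C" "tsp.span C = W"
    using someI[of "\<lambda>B. B \<subseteq> W \<and> tsp.independent B \<and> tsp.span B = W" B]
    unfolding C_def by auto
  have "t \<in> tsp.span (basis_tensor ` words n)" if "t \<in> tpower n" for t
    by (subst tensor_expand[OF that], unfold lin_ext_def)
      (intro tsp.span_sum tsp.span_scale tsp.span_base imageI)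
  hence fC: "finite C"
    using tsp.independent_span_bound[of "basis_tensor ` words n" C] C W finite_words by auto
  have e: "f (basis_tensor w) \<in> W" if "w \<in> words n" for w
    using that by (auto simp: words_def intro!: f(2) basis_tensor_tpower)
  have "word_trace n f =
      (\<Sum>w\<in>words n. \<Sum>b\<in>C. tsp.representation C (f (basis_tensor w)) b * b w)"
    unfolding word_trace_def
  proof (rule sum.cong)
    fix w assume "w \<in> words n"
    hence "f (basis_tensor w) = (\<Sum>b\<in>C. tscale (tsp.representation C (f (basis_tensor w)) b) b)"
      using tsp.sum_representation_eq[of C "f (basis_tensor w)" C] C fC e by auto
    thus "f (basis_tensor w) w = (\<Sum>b\<in>C. tsp.representation C (f (basis_tensor w)) b * b w)"
      by (metis (no_types, lifting) sum.cong sum_tensor_apply tscale_apply)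
  qed simp
  also have "\<dots> = (\<Sum>b\<in>C. \<Sum>w\<in>words n. b w * tsp.representation C (f (basis_tensor w)) b)"
    by (subst sum.swap) (simp add: mult.commute)
  also have "\<dots> = (\<Sum>b\<in>C. tsp.representation C (f b) b)"
  proof (rule sum.cong)
    fix b assume "b \<in> C"
    hence b: "b \<in> tpower n" using C W by auto
    show "(\<Sum>w\<in>words n. b w * tsp.representation C (f (basis_tensor w)) b) =
        tsp.representation C (f b) b"
      unfolding lin_expand[OF f(1) b]
      using C e by (subst tsp.representation_sum)
        (auto simp: tsp.representation_scale tsp.span_scale)
  qed simp
  finally show ?thesis by (simp add: trace_on_def C_def[symmetric] Let_def)
qed

text \<open>
  Taking \<open>\<alpha>\<close>, \<open>\<beta>\<close>, \<open>\<gamma>\<close> as parameters avoids halves and side conditions: the admissible triples are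
  exactly those of the form \<open>(\<beta> + \<gamma>, \<gamma> + \<alpha>, \<beta> + \<alpha>)\<close>.
\<close>

definition central_map ::
    "nat \<Rightarrow> nat \<Rightarrow> nat \<Rightarrow> complex^2^2 \<Rightarrow> complex^2^2 \<Rightarrow> tensor \<Rightarrow> tensor" where
  "central_map \<alpha> \<beta> \<gamma> x1 x2 =
     symmetrizer (\<beta> + \<alpha>) \<circ> pad \<beta> (2 * \<gamma>) \<alpha> (caps \<gamma>) \<circ>
     map_otimes (\<beta> + \<gamma>) (\<gamma> + \<alpha>) (action_power (\<beta> + \<gamma>) x1) (action_power (\<gamma> + \<alpha>) x2) \<circ>
     map_otimes (\<beta> + \<gamma>) (\<gamma> + \<alpha>) (symmetrizer (\<beta> + \<gamma>)) (symmetrizer (\<gamma> + \<alpha>)) \<circ>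
     pad \<beta> 0 \<alpha> (cups \<gamma>)"

lemma intertwines_central_map:
  assumes "det g = 1" "y1 ** g = g ** x1" "y2 ** g = g ** x2"
  shows "intertwines g (\<beta> + \<alpha>) (\<beta> + \<alpha>) (central_map \<alpha> \<beta> \<gamma> x1 x2) (central_map \<alpha> \<beta> \<gamma> y1 y2)"
proof -
  have 1: "intertwines g (\<beta> + \<alpha>) ((\<beta> + \<gamma>) + (\<gamma> + \<alpha>)) (pad \<beta> 0 \<alpha> (cups \<gamma>)) (pad \<beta> 0 \<alpha> (cups \<gamma>))"
    using intertwines_pad[OF intertwines_cups[OF assms(1)], of \<beta> \<alpha> \<gamma>] by (simp add: mult_2 add_ac)
  have 2: "intertwines g ((\<beta> + \<gamma>) + (\<gamma> + \<alpha>)) (\<beta> + \<alpha>)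
      (pad \<beta> (2 * \<gamma>) \<alpha> (caps \<gamma>)) (pad \<beta> (2 * \<gamma>) \<alpha> (caps \<gamma>))"
    using intertwines_pad[OF intertwines_caps[OF assms(1)], of \<beta> \<gamma> \<alpha>] by (simp add: mult_2 add_ac)
  have 3: "intertwines g ((\<beta> + \<gamma>) + (\<gamma> + \<alpha>)) ((\<beta> + \<gamma>) + (\<gamma> + \<alpha>))
      (map_otimes (\<beta> + \<gamma>) (\<gamma> + \<alpha>) (symmetrizer (\<beta> + \<gamma>)) (symmetrizer (\<gamma> + \<alpha>)))
      (map_otimes (\<beta> + \<gamma>) (\<gamma> + \<alpha>) (symmetrizer (\<beta> + \<gamma>)) (symmetrizer (\<gamma> + \<alpha>)))"
    by (intro intertwines_map_otimes intertwines_symmetrizer)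
  have 4: "intertwines g ((\<beta> + \<gamma>) + (\<gamma> + \<alpha>)) ((\<beta> + \<gamma>) + (\<gamma> + \<alpha>))
      (map_otimes (\<beta> + \<gamma>) (\<gamma> + \<alpha>) (action_power (\<beta> + \<gamma>) x1) (action_power (\<gamma> + \<alpha>) x2))
      (map_otimes (\<beta> + \<gamma>) (\<gamma> + \<alpha>) (action_power (\<beta> + \<gamma>) y1) (action_power (\<gamma> + \<alpha>) y2))"
    by (intro intertwines_map_otimes intertwines_action_power assms)
  show ?thesis unfolding central_map_def
    using intertwines_comp[OF intertwines_comp[OF intertwines_comp[OF intertwines_comp[OF 1 3] 4] 2]
        intertwines_symmetrizer]
    by (simp only: comp_assoc)
qed

lemma lin_central_map: "lin (central_map \<alpha> \<beta> \<gamma> x1 x2)"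
  unfolding central_map_def by (intro lin_comp lin_pad lin_map_otimes lin_symmetrizer)

lemma central_function_eq_word_trace:
  "central_function (\<beta> + \<gamma>) (\<gamma> + \<alpha>) (\<beta> + \<alpha>) x1 x2 = word_trace (\<beta> + \<alpha>) (central_map \<alpha> \<beta> \<gamma> x1 x2)"
proof -
  have eq: "nat \<lfloor>alpha (\<beta> + \<gamma>) (\<gamma> + \<alpha>) (\<beta> + \<alpha>)\<rfloor> = \<alpha>" "nat \<lfloor>beta (\<beta> + \<gamma>) (\<gamma> + \<alpha>) (\<beta> + \<alpha>)\<rfloor> = \<beta>"
    "nat \<lfloor>gamma (\<beta> + \<gamma>) (\<gamma> + \<alpha>) (\<beta> + \<alpha>)\<rfloor> = \<gamma>"
    by (simp_all add: alpha_def beta_def gamma_def)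
  have sub: "tsp.subspace (sym_space n)" for n
  proof -
    interpret s: Vector_Spaces.linear tscale tscale "symmetrizer n" by (rule lin_symmetrizer)
    have "tsp.subspace (tpower n)"
      by (auto simp: tsp.subspace_def tpower_def tscale_apply)
    thus ?thesis unfolding sym_space_def by (rule s.subspace_image)
  qed
  have range: "symmetrizer n t \<in> sym_space n" for n t
  proof -
    have "symmetrizer n t = symmetrizer n (\<lambda>w. if w \<in> words n then t w else 0)"
      by (simp add: symmetrizer_def lin_ext_def)
    thus ?thesis unfolding sym_space_def by (auto simp: tpower_def)
  qed
  have "trace_on (sym_space (\<beta> + \<alpha>)) (central_map \<alpha> \<beta> \<gamma> x1 x2) =
      word_trace (\<beta> + \<alpha>) (central_map \<alpha> \<beta> \<gamma> x1 x2)"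
    by (rule trace_on_eq_word_trace[OF sub _ lin_central_map])
      (auto simp: sym_space_def symmetrizer_tpower central_map_def range[unfolded sym_space_def])
  thus ?thesis
    by (simp add: central_function_def central_map_def iota_def proj_def eq comp_assoc)
qed

text \<open>
  With \<open>R\<close> the action of \<open>g\<close>, the maps whose traces are the two central functions are conjugate by
  \<open>R\<close>, so that \<open>word_trace_comp_commute\<close> applies.
\<close>

proposition central_function_conjugation:
  assumes g: "det g = 1" "y1 ** g = g ** x1" "y2 ** g = g ** x2"
  shows "central_function (\<beta> + \<gamma>) (\<gamma> + \<alpha>) (\<beta> + \<alpha>) y1 y2 =
    central_function (\<beta> + \<gamma>) (\<gamma> + \<alpha>) (\<beta> + \<alpha>) x1 x2"
proof -
  let ?n = "\<beta> + \<alpha>"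
  obtain h where h: "g ** h = mat 1" "h ** g = mat 1"
    using g(1) by (metis invertible_def invertible_det_nz zero_neq_one)
  let ?X = "central_map \<alpha> \<beta> \<gamma> x1 x2" and ?Y = "central_map \<alpha> \<beta> \<gamma> y1 y2"
  let ?g = "action_power ?n g" and ?h = "action_power ?n h"
  have inv: "action_power n p (action_power n q (basis_tensor w)) = basis_tensor w"
    if "p ** q = mat 1" "length w = n" for n p q w
    using that by (simp add: basis_tensor_def action_power_pure_tensor comp_def
        matrix_vector_mul_assoc)
  have iw: "intertwines g ?n ?n ?X ?Y" by (rule intertwines_central_map[OF g])
  have X: "?X t \<in> tpower ?n" if "t \<in> tpower ?n" for t
    using iw that by (simp add: intertwines_def)
  have "word_trace ?n ?Y = word_trace ?n (?g \<circ> (?X \<circ> ?h))"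
    unfolding word_trace_def
  proof (rule sum.cong)
    fix w assume "w \<in> words ?n"
    hence w: "length w = ?n" by (simp add: words_def)
    have "?Y (?g (?h (basis_tensor w))) = ?g (?X (?h (basis_tensor w)))"
      using iw w by (simp add: intertwines_def action_power_tpower basis_tensor_tpower)
    thus "?Y (basis_tensor w) w = (?g \<circ> (?X \<circ> ?h)) (basis_tensor w) w"
      using inv[OF h(1) w] by simp
  qed simp
  also have "\<dots> = word_trace ?n ((?X \<circ> ?h) \<circ> ?g)"
    by (rule word_trace_comp_commute) (auto intro!: lin_comp lin_action_power lin_central_map
        action_power_tpower X simp del: o_apply, auto intro!: X action_power_tpower)
  also have "\<dots> = word_trace ?n ?X"
    unfolding word_trace_def by (rule sum.cong) (auto simp: words_def inv[OF h(2)])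
  finally show ?thesis by (simp add: central_function_eq_word_trace)
qed

section \<open>Central functions as state sums\<close>

lemma basis_tensor_Nil_otimes:
  assumes "s \<in> tpower 0" "t \<in> tpower n"
  shows "otimes s t = tscale (s []) t"
  using assms(2)
  by (auto simp: fun_eq_iff otimes_apply[OF assms] tscale_apply tpower_def words_def)

lemma pad_0_apply:
  assumes f: "f (basis_tensor []) \<in> tpower k" and T: "T \<in> tpower (m + n)"
    and t: "length t = m + (k + n)"
  shows "pad m 0 n f T t = T (take m t @ drop (m + k) t) * f (basis_tensor []) (take k (drop m t))"
proof -
  have *: "pad m 0 n f (basis_tensor w) t =
      (if w = take m t @ drop (m + k) t then f (basis_tensor []) (take k (drop m t)) else 0)"
    if "length w = m + n" for w
  proof -
    have w: "basis_tensor (take m w) \<in> tpower m" "basis_tensor (drop m w) \<in> tpower n"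
      using that by (auto intro!: basis_tensor_tpower)
    have "pad m 0 n f (basis_tensor w) =
        otimes (basis_tensor (take m w)) (otimes (f (basis_tensor [])) (basis_tensor (drop m w)))"
      using that by (simp add: pad_basis_tensor)
    hence "pad m 0 n f (basis_tensor w) t = basis_tensor (take m w) (take m t) *
        (f (basis_tensor []) (take k (drop m t)) * basis_tensor (drop m w) (drop (k + m) t))"
      using t by (simp add: otimes_apply[OF w(1) otimes_tpower[OF f w(2)]] otimes_apply[OF f w(2)])
    moreover have "w = take m t @ drop (m + k) t \<longleftrightarrow>
        take m w = take m t \<and> drop m w = drop (m + k) t"
      using t that by (metis append_eq_conv_conj append_take_drop_id length_take min.absorb2 le_add1)
    ultimately show ?thesis by (auto simp: basis_tensor_apply add.commute)
  qed
  have "pad m 0 n f T t = (\<Sum>w\<in>words (m + n). T w * pad m 0 n f (basis_tensor w) t)"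
    by (rule lin_expand_apply[OF lin_pad T])
  also have "\<dots> = (\<Sum>w\<in>words (m + n). if w = take m t @ drop (m + k) t
      then T w * f (basis_tensor []) (take k (drop m t)) else 0)"
    by (rule sum.cong) (auto simp: words_def *)
  also have "\<dots> = T (take m t @ drop (m + k) t) * f (basis_tensor []) (take k (drop m t))"
    using t by (simp add: finite_words) (simp add: words_def)
  finally show ?thesis .
qed

lemma pad_scalar_basis_tensor:
  assumes "\<And>u. length u = k \<Longrightarrow> f (basis_tensor u) \<in> tpower 0" and "length w = m + (k + n)"
  shows "pad m k n f (basis_tensor w) =
    tscale (f (basis_tensor (take k (drop m w))) []) (basis_tensor (take m w @ drop (m + k) w))"
proof -
  let ?u = "basis_tensor (take m w)" and ?v = "basis_tensor (drop (m + k) w)"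
  have uv: "?u \<in> tpower m" "?v \<in> tpower n" "f (basis_tensor (take k (drop m w))) \<in> tpower 0"
    using assms by (auto intro!: basis_tensor_tpower)
  have "otimes s (tscale c t) = tscale c (otimes s t)" for s c t
    by (simp add: otimes_def fun_eq_iff tscale_apply sum_distrib_left mult_ac)
  thus ?thesis
    using assms(2) uv
    by (simp add: pad_basis_tensor basis_tensor_Nil_otimes[where n = n] basis_tensor_append)
qed

text \<open>
  The coordinates of the nested cup, and likewise of the nested cap: every arc joins two positions
  symmetric about the centre of the word, and contributes the factor \<open>1\<close>, \<open>-1\<close> or \<open>0\<close>.
\<close>

definition cup_coeff :: "nat \<Rightarrow> 2 list \<Rightarrow> complex" where
  "cup_coeff n w = (if length w = 2 * n
     then \<Prod>k<n. det2 (axis (w ! k) 1) (axis (w ! (2 * n - 1 - k)) 1) else 0)"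

lemma cup_coeff_Suc:
  assumes "length w = n + (2 + n)"
  shows "cup_coeff (Suc n) w =
    cup_coeff n (take n w @ drop (n + 2) w) * det2 (axis (w ! n) 1) (axis (w ! Suc n) 1)"
proof -
  have "(take n w @ drop (n + 2) w) ! k = w ! k" "(take n w @ drop (n + 2) w) ! (2 * n - 1 - k) =
      w ! (2 * Suc n - 1 - k)" if "k < n" for k
  proof -
    have "2 * n - 1 - k - n + (n + 2) = 2 * Suc n - 1 - k" using that by simp
    thus "(take n w @ drop (n + 2) w) ! (2 * n - 1 - k) = w ! (2 * Suc n - 1 - k)"
      using that assms by (simp add: nth_append add.commute)
  qed (use that assms in \<open>simp add: nth_append\<close>)
  thus ?thesis using assms by (simp add: cup_coeff_def)
qed

lemma length_2_take_drop: "length t = n + (2 + m) \<Longrightarrow> take 2 (drop n t) = [t ! n, t ! Suc n]"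
  by (auto simp: list_eq_iff_nth_eq less_Suc_eq numeral_2_eq_2)

lemma cups_basis_tensor: "cups n (basis_tensor []) = cup_coeff n"
proof (induction n)
  case 0
  show ?case by (auto simp: cup_coeff_def basis_tensor_apply)
next
  case (Suc n)
  have cup: "cup (basis_tensor []) [i, j] = det2 (axis i 1) (axis j 1)" for i j
    using exhaust_2[of i] exhaust_2[of j]
    by (auto simp: cup_def basis_tensor_apply tscale_apply pure_tensor_def det2_eq axis_def
        lessThan_Suc)
  show ?case
  proof
    fix t :: "2 list"
    have T: "cup_coeff n \<in> tpower (n + n)"
      by (simp add: tpower_def words_def cup_coeff_def mult_2)
    show "cups (Suc n) (basis_tensor []) t = cup_coeff (Suc n) t"
    proof (cases "length t = n + (2 + n)")
      case True
      show ?thesis using pad_0_apply[OF cup_tpower T True]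
        by (simp add: Suc cup_coeff_Suc True length_2_take_drop cup)
    next
      case False
      have "cups (Suc n) (basis_tensor []) \<in> tpower (2 * Suc n)"
        by (intro cups_tpower basis_tensor_tpower) simp
      thus ?thesis using False by (simp add: tpower_def words_def cup_coeff_def)
    qed
  qed
qed

lemma caps_basis_tensor: "length w = 2 * n \<Longrightarrow> caps n (basis_tensor w) [] = cup_coeff n w"
proof (induction n arbitrary: w)
  case 0
  thus ?case by (simp add: cup_coeff_def basis_tensor_apply)
next
  case (Suc n)
  interpret c: Vector_Spaces.linear tscale tscale "caps n" by (rule lin_caps)
  have w: "length w = n + (2 + n)" using Suc.prems by simp
  have "cap (basis_tensor [i, j]) [] = det2 (axis i 1) (axis j 1)" for i j
    unfolding basis_tensor_def list.map cap_pure_tensor by (simp add: tscale_apply pure_tensor_def)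
  thus ?case
    by (simp add: pad_scalar_basis_tensor[OF cap_tpower w] c.scale tscale_apply Suc.IH w
        cup_coeff_Suc length_2_take_drop)
qed

text \<open>
  The common matrix entry of the two maps \<open>id \<otimes> cup\<^sub>\<gamma> \<otimes> id\<close> and \<open>id \<otimes> cap\<^sub>\<gamma> \<otimes> id\<close>, which are
  transposes of each other: \<open>w\<close> is the word of the outer strands, and \<open>k\<close> is \<open>w\<close> with the ends of
  \<open>\<gamma>\<close> arcs inserted.
\<close>

definition bracket :: "nat \<Rightarrow> nat \<Rightarrow> nat \<Rightarrow> 2 list \<Rightarrow> 2 list \<Rightarrow> complex" where
  "bracket \<alpha> \<beta> \<gamma> w k = (if length k = \<beta> + (2 * \<gamma> + \<alpha>) \<and> take \<beta> k @ drop (\<beta> + 2 * \<gamma>) k = w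
     then cup_coeff \<gamma> (take (2 * \<gamma>) (drop \<beta> k)) else 0)"

lemma pad_cups_apply:
  assumes "length w = \<beta> + \<alpha>"
  shows "pad \<beta> 0 \<alpha> (cups \<gamma>) (basis_tensor w) k = bracket \<alpha> \<beta> \<gamma> w k"
proof (cases "length k = \<beta> + (2 * \<gamma> + \<alpha>)")
  case True
  have C: "cups \<gamma> (basis_tensor []) \<in> tpower (2 * \<gamma>)"
    by (intro cups_tpower basis_tensor_tpower) simp
  show ?thesis
    using pad_0_apply[where f = "cups \<gamma>", OF C basis_tensor_tpower[OF assms] True] True
    by (simp add: bracket_def cups_basis_tensor basis_tensor_apply)
next
  case False
  have "pad \<beta> 0 \<alpha> (cups \<gamma>) (basis_tensor w) \<in> tpower (\<beta> + (2 * \<gamma> + \<alpha>))"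
    by (rule pad_tpower) (use assms in \<open>auto intro!: cups_tpower basis_tensor_tpower\<close>)
  thus ?thesis using False by (simp add: bracket_def tpower_def words_def)
qed

lemma pad_caps_apply:
  assumes "length k = \<beta> + (2 * \<gamma> + \<alpha>)"
  shows "pad \<beta> (2 * \<gamma>) \<alpha> (caps \<gamma>) (basis_tensor k) w = bracket \<alpha> \<beta> \<gamma> w k"
proof -
  have C: "caps \<gamma> (basis_tensor u) \<in> tpower 0" if "length u = 2 * \<gamma>" for u
    using that by (intro caps_tpower basis_tensor_tpower)
  show ?thesis
    using assms pad_scalar_basis_tensor[where f = "caps \<gamma>", OF C assms]
    by (auto simp: bracket_def tscale_apply basis_tensor_apply caps_basis_tensor)
qed

definition sym_action_entry :: "nat \<Rightarrow> complex^2^2 \<Rightarrow> 2 list \<Rightarrow> 2 list \<Rightarrow> complex" where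
  "sym_action_entry n x s t =
     (\<Sum>r\<in>words n. symmetrizer n (basis_tensor s) r * (\<Prod>i<n. x $ (t ! i) $ (r ! i)))"

lemma action_symmetrizer_apply:
  "length t = n \<Longrightarrow> action_power n x (symmetrizer n (basis_tensor s)) t = sym_action_entry n x s t"
  by (subst lin_expand_apply[OF lin_action_power symmetrizer_tpower], unfold sym_action_entry_def,
      rule sum.cong) (auto simp: words_def action_power_basis_tensor)

text \<open>
  The composition of the maps, read from right to left: the word \<open>w\<close> is extended by the cups to
  \<open>k\<close>, the symmetrized matrices lead from \<open>k\<close> to \<open>k'\<close>, and the caps lead to \<open>w'\<close>, which the last
  symmetrizer permutes back to \<open>w\<close>. The words \<open>k\<close> and \<open>k'\<close> are cut into the part acted upon by \<open>x1\<close>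
  and the part acted upon by \<open>x2\<close>.
\<close>

proposition central_function_state_sum:
  "central_function (\<beta> + \<gamma>) (\<gamma> + \<alpha>) (\<beta> + \<alpha>) x1 x2 =
    (\<Sum>w\<in>words (\<beta> + \<alpha>). \<Sum>k\<in>words ((\<beta> + \<gamma>) + (\<gamma> + \<alpha>)).
     \<Sum>k'\<in>words ((\<beta> + \<gamma>) + (\<gamma> + \<alpha>)). \<Sum>w'\<in>words (\<beta> + \<alpha>).
      bracket \<alpha> \<beta> \<gamma> w k * bracket \<alpha> \<beta> \<gamma> w' k' * symmetrizer (\<beta> + \<alpha>) (basis_tensor w') w *
      sym_action_entry (\<beta> + \<gamma>) x1 (take (\<beta> + \<gamma>) k) (take (\<beta> + \<gamma>) k') *
      sym_action_entry (\<gamma> + \<alpha>) x2 (drop (\<beta> + \<gamma>) k) (drop (\<beta> + \<gamma>) k'))"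
proof -
  let ?a = "\<beta> + \<gamma>" and ?b = "\<gamma> + \<alpha>" and ?c = "\<beta> + \<alpha>"
  define U where "U = pad \<beta> 0 \<alpha> (cups \<gamma>)"
  define M where "M = map_otimes ?a ?b (action_power ?a x1) (action_power ?b x2) \<circ>
    map_otimes ?a ?b (symmetrizer ?a) (symmetrizer ?b)"
  define L where "L = symmetrizer ?c \<circ> pad \<beta> (2 * \<gamma>) \<alpha> (caps \<gamma>)"
  have linL: "lin L" and linM: "lin M"
    unfolding L_def M_def by (intro lin_comp lin_pad lin_map_otimes lin_symmetrizer)+
  have N: "\<beta> + (2 * \<gamma> + \<alpha>) = ?a + ?b" by simp
  have Ub: "U (basis_tensor w) k = bracket \<alpha> \<beta> \<gamma> w k" if "w \<in> words ?c" for w k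
    using that by (simp add: U_def pad_cups_apply words_def)
  have Ut: "U (basis_tensor w) \<in> tpower (?a + ?b)" if "w \<in> words ?c" for w
    using that N by (auto simp: tpower_def Ub bracket_def words_def)
  have Mb: "M (basis_tensor k) = otimes (action_power ?a x1 (symmetrizer ?a (basis_tensor (take ?a k))))
      (action_power ?b x2 (symmetrizer ?b (basis_tensor (drop ?a k))))"
    if "k \<in> words (?a + ?b)" for k
  proof -
    have "M (basis_tensor k) = map_otimes ?a ?b (action_power ?a x1) (action_power ?b x2)
        (otimes (symmetrizer ?a (basis_tensor (take ?a k)))
          (symmetrizer ?b (basis_tensor (drop ?a k))))"
      using that by (simp add: M_def map_otimes_basis_tensor words_def)
    thus ?thesis
      by (simp only: map_otimes_otimes lin_action_power symmetrizer_tpower)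
  qed
  have Mt: "M (basis_tensor k) \<in> tpower (?a + ?b)" if "k \<in> words (?a + ?b)" for k
    unfolding Mb[OF that] by (intro otimes_tpower action_power_tpower symmetrizer_tpower)
  have Me: "M (basis_tensor k) k' = sym_action_entry ?a x1 (take ?a k) (take ?a k') *
      sym_action_entry ?b x2 (drop ?a k) (drop ?a k')"
    if "k \<in> words (?a + ?b)" "k' \<in> words (?a + ?b)" for k k'
    using that(2) unfolding Mb[OF that(1)]
    by (subst otimes_apply[where m = ?a and n = ?b])
      (auto intro!: action_power_tpower symmetrizer_tpower
        simp: words_def action_symmetrizer_apply)
  have Lb: "L (basis_tensor k) w =
      (\<Sum>w'\<in>words ?c. bracket \<alpha> \<beta> \<gamma> w' k * symmetrizer ?c (basis_tensor w') w)"
    if "k \<in> words (?a + ?b)" for k w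
  proof -
    have k: "length k = \<beta> + (2 * \<gamma> + \<alpha>)" using that by (simp add: words_def)
    have "pad \<beta> (2 * \<gamma>) \<alpha> (caps \<gamma>) (basis_tensor k) \<in> tpower ?c"
      using k by (auto simp: tpower_def pad_caps_apply bracket_def words_def)
    hence "L (basis_tensor k) w = (\<Sum>w'\<in>words ?c.
        pad \<beta> (2 * \<gamma>) \<alpha> (caps \<gamma>) (basis_tensor k) w' * symmetrizer ?c (basis_tensor w') w)"
      unfolding L_def o_apply by (rule lin_expand_apply[OF lin_symmetrizer])
    thus ?thesis by (simp add: pad_caps_apply k)
  qed
  have "central_function ?a ?b ?c x1 x2 = (\<Sum>w\<in>words ?c. L (M (U (basis_tensor w))) w)"
    by (simp add: central_function_eq_word_trace word_trace_def central_map_def U_def M_def L_def)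
  also have "\<dots> = (\<Sum>w\<in>words ?c. \<Sum>k\<in>words (?a + ?b). \<Sum>k'\<in>words (?a + ?b). \<Sum>w'\<in>words ?c.
      bracket \<alpha> \<beta> \<gamma> w k * bracket \<alpha> \<beta> \<gamma> w' k' * symmetrizer ?c (basis_tensor w') w *
      sym_action_entry ?a x1 (take ?a k) (take ?a k') *
      sym_action_entry ?b x2 (drop ?a k) (drop ?a k'))"
  proof (rule sum.cong)
    fix w assume w: "w \<in> words ?c"
    have "L (M (U (basis_tensor w))) w =
        (\<Sum>k\<in>words (?a + ?b). bracket \<alpha> \<beta> \<gamma> w k * L (M (basis_tensor k)) w)"
      using lin_expand_apply[OF lin_comp[OF linM linL] Ut[OF w], of w] w by (simp add: Ub)
    also have "\<dots> = (\<Sum>k\<in>words (?a + ?b). bracket \<alpha> \<beta> \<gamma> w k *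
        (\<Sum>k'\<in>words (?a + ?b). M (basis_tensor k) k' * L (basis_tensor k') w))"
      by (intro sum.cong refl arg_cong[where f = "(*) _"] lin_expand_apply[OF linL] Mt)
    also have "\<dots> = (\<Sum>k\<in>words (?a + ?b). \<Sum>k'\<in>words (?a + ?b). \<Sum>w'\<in>words ?c.
        bracket \<alpha> \<beta> \<gamma> w k * bracket \<alpha> \<beta> \<gamma> w' k' * symmetrizer ?c (basis_tensor w') w *
        sym_action_entry ?a x1 (take ?a k) (take ?a k') *
        sym_action_entry ?b x2 (drop ?a k) (drop ?a k'))"
      by (intro sum.cong refl) (simp add: Me Lb sum_distrib_left mult_ac)
    finally show "L (M (U (basis_tensor w))) w = \<dots>" .
  qed simp
  finally show ?thesis .
qed

section \<open>Polynomials in three variables\<close>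

lemma poly3_eval_superset:
  assumes "finite S" "Poly_Mapping.keys p \<subseteq> S"
  shows "poly3_eval p x y z =
    (\<Sum>(i, j, k)\<in>S. Poly_Mapping.lookup p (i, j, k) * x ^ i * y ^ j * z ^ k)"
  unfolding poly3_eval_def using assms
  by (intro sum.mono_neutral_left) (auto simp: in_keys_iff)

lemma poly3_eval_add: "poly3_eval (p + q) x y z = poly3_eval p x y z + poly3_eval q x y z"
proof -
  let ?S = "Poly_Mapping.keys p \<union> Poly_Mapping.keys q"
  have "Poly_Mapping.keys (p + q) \<subseteq> ?S" by (rule keys_add)
  hence "poly3_eval (p + q) x y z =
      (\<Sum>(i, j, k)\<in>?S. Poly_Mapping.lookup (p + q) (i, j, k) * x ^ i * y ^ j * z ^ k)"
    by (intro poly3_eval_superset) auto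
  thus ?thesis
    by (simp add: poly3_eval_superset[of ?S p] poly3_eval_superset[of ?S q] lookup_add
        case_prod_unfold distrib_right flip: sum.distrib)
qed

lemma poly3_eval_diff: "poly3_eval (p - q) x y z = poly3_eval p x y z - poly3_eval q x y z"
  using poly3_eval_add[of "p - q" q x y z] by simp

lemma poly3_eval_single:
  "poly3_eval (Poly_Mapping.single (i, j, k) c) x y z = c * x ^ i * y ^ j * z ^ k"
  by (subst poly3_eval_superset[where S = "{(i, j, k)}"]) (auto simp: in_keys_iff lookup_single)

text \<open>
  Kronecker's substitution \<open>x = t\<close>, \<open>y = t ^ N\<close>, \<open>z = t ^ (N * N)\<close> with \<open>N\<close> above all exponents
  turns distinct monomials into distinct powers of \<open>t\<close>, which reduces the claim to polynomials
  in one variable. Zeros at the points with nonzero coordinates suffice; this matters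
  for top homogeneous parts, which are obtained as limits along curves that contain \<open>1 / \<eta>\<close>.
\<close>

lemma poly3_coeffs_zero:
  fixes c :: "nat \<times> nat \<times> nat \<Rightarrow> complex"
  assumes "finite S"
    and zero: "\<And>x y z. x \<noteq> 0 \<Longrightarrow> y \<noteq> 0 \<Longrightarrow> z \<noteq> 0 \<Longrightarrow> (\<Sum>(i, j, k)\<in>S. c (i, j, k) * x ^ i * y ^ j * z ^ k) = 0"
    and "m \<in> S"
  shows "c m = 0"
proof -
  define N where "N = Suc (\<Sum>(i, j, k)\<in>S. i + j + k)"
  define \<phi> where "\<phi> = (\<lambda>(i, j, k). i + N * (j + N * k))"
  have less: "i < N \<and> j < N \<and> k < N" if "(i, j, k) \<in> S" for i j k
    using member_le_sum[OF that, of "\<lambda>(i, j, k). i + j + k"] \<open>finite S\<close> by (auto simp: N_def)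
  have "inj_on \<phi> S"
  proof (rule inj_onI)
    fix m m' assume m: "m \<in> S" "m' \<in> S" "\<phi> m = \<phi> m'"
    obtain i j k i' j' k' where ijk: "m = (i, j, k)" "m' = (i', j', k')"
      by (metis prod_cases3)
    have l: "i < N" "j < N" "i' < N" "j' < N" using less m ijk by auto
    have eq: "i + N * (j + N * k) = i' + N * (j' + N * k')" using m ijk by (simp add: \<phi>_def)
    have 1: "i = i'" using arg_cong[OF eq, of "\<lambda>n. n mod N"] l by simp
    have 2: "j + N * k = j' + N * k'" using eq 1 l by simp
    have 3: "j = j'" using arg_cong[OF 2, of "\<lambda>n. n mod N"] l by simp
    show "m = m'" using 1 2 3 l ijk by simp
  qed
  define P where "P = (\<Sum>m\<in>S. monom (c m) (\<phi> m))"
  have "poly P t = 0" if "t \<noteq> 0" for t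
  proof -
    have "poly P t = (\<Sum>(i, j, k)\<in>S. c (i, j, k) * t ^ i * (t ^ N) ^ j * (t ^ (N * N)) ^ k)"
      unfolding P_def poly_sum
      by (rule sum.cong)
        (auto simp: poly_monom \<phi>_def power_add power_mult[symmetric] algebra_simps)
    also have "\<dots> = 0" using that by (intro zero) auto
    finally show ?thesis .
  qed
  hence "UNIV - {0} \<subseteq> {t. poly P t = 0}" by auto
  moreover have "infinite (UNIV - {0 :: complex})" by (simp add: infinite_UNIV_char_0)
  ultimately have "P = 0" using poly_roots_finite finite_subset by blast
  moreover have "coeff P (\<phi> m) = c m"
  proof -
    have "coeff P (\<phi> m) = (\<Sum>m'\<in>S. if m' = m then c m' else 0)"
      unfolding P_def coeff_sum using \<open>inj_on \<phi> S\<close> \<open>m \<in> S\<close>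
      by (intro sum.cong) (auto simp: inj_on_def)
    thus ?thesis using \<open>finite S\<close> \<open>m \<in> S\<close> by simp
  qed
  ultimately show ?thesis by simp
qed

lemma poly3_eqI:
  assumes "\<And>x y z. poly3_eval p x y z = poly3_eval q x y z"
  shows "p = q"
proof -
  have "Poly_Mapping.lookup (p - q) m = 0" if "m \<in> Poly_Mapping.keys (p - q)" for m
    using that by (rule poly3_coeffs_zero[rotated 2])
      (use assms in \<open>auto simp: poly3_eval_diff simp flip: poly3_eval_def\<close>)
  hence "p - q = 0" by (metis in_keys_iff keys_eq_empty ex_in_conv)
  thus ?thesis by simp
qed

definition poly_function :: "(complex \<Rightarrow> complex \<Rightarrow> complex \<Rightarrow> complex) \<Rightarrow> bool" where
  "poly_function f \<longleftrightarrow> (\<exists>P. \<forall>x y z. f x y z = poly3_eval P x y z)"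

lemma poly_function_monomial: "poly_function (\<lambda>x y z. c * x ^ i * y ^ j * z ^ k)"
  unfolding poly_function_def by (metis poly3_eval_single)

lemma poly_function_const: "poly_function (\<lambda>x y z. c)"
  using poly_function_monomial[of c 0 0 0] by simp

lemma poly_function_vars:
  "poly_function (\<lambda>x y z. x)" "poly_function (\<lambda>x y z. y)" "poly_function (\<lambda>x y z. z)"
  using poly_function_monomial[of 1 1 0 0] poly_function_monomial[of 1 0 1 0]
    poly_function_monomial[of 1 0 0 1] by simp_all

lemma poly_function_add:
  "poly_function f \<Longrightarrow> poly_function g \<Longrightarrow> poly_function (\<lambda>x y z. f x y z + g x y z)"
  unfolding poly_function_def by (metis poly3_eval_add)

lemma poly_function_sum:
  "(\<And>i. i \<in> I \<Longrightarrow> poly_function (f i)) \<Longrightarrow> poly_function (\<lambda>x y z. \<Sum>i\<in>I. f i x y z)"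
  by (induction I rule: infinite_finite_induct) (auto intro: poly_function_add poly_function_const)

lemma poly_function_mult:
  assumes "poly_function f" "poly_function g"
  shows "poly_function (\<lambda>x y z. f x y z * g x y z)"
proof -
  obtain P Q where "f = poly3_eval P" "g = poly3_eval Q"
    using assms by (auto simp: poly_function_def fun_eq_iff)
  hence "(\<lambda>x y z. f x y z * g x y z) = (\<lambda>x y z.
      \<Sum>m\<in>Poly_Mapping.keys P. \<Sum>n\<in>Poly_Mapping.keys Q.
        (Poly_Mapping.lookup P m * Poly_Mapping.lookup Q n) *
        x ^ (fst m + fst n) * y ^ (fst (snd m) + fst (snd n)) * z ^ (snd (snd m) + snd (snd n)))"
    by (simp add: poly3_eval_def sum_product case_prod_unfold power_add mult_ac)
  thus ?thesis by (simp only:) (intro poly_function_sum poly_function_monomial)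
qed

text \<open>
  If \<open>d \<ge> n\<close> were the degree of \<open>Q\<close>, then \<open>\<nu> ^ (2 * d)\<close> times the value of \<open>Q\<close> would tend to the
  homogeneous part of degree \<open>d\<close> at \<open>(\<xi>, \<eta>, \<zeta>)\<close>, which would therefore vanish identically. The
  summand \<open>\<nu>^2 / \<eta>\<close> is the inverse of \<open>\<eta> / \<nu>^2\<close> and tends to \<open>0\<close>: the second argument is the trace
  of a matrix of determinant \<open>1\<close> with these two eigenvalues.
\<close>

lemma total_degree_less_if_tendsto:
  fixes Q :: poly3
  assumes lim: "\<And>\<xi> \<eta> \<zeta>. \<xi> \<noteq> 0 \<Longrightarrow> \<eta> \<noteq> 0 \<Longrightarrow> \<zeta> \<noteq> 0 \<Longrightarrow>
    ((\<lambda>\<nu>. \<nu> ^ (2 * n) * poly3_eval Q (\<xi> / \<nu>^2) (\<eta> / \<nu>^2 + \<nu>^2 / \<eta>) (\<zeta> / \<nu>^2)) \<longlongrightarrow> 0) (at 0)"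
  shows "total_degree_less Q n"
proof (rule ccontr)
  let ?deg = "\<lambda>(i, j, k). i + j + k :: nat"
  let ?K = "Poly_Mapping.keys Q"
  let ?c = "Poly_Mapping.lookup Q"
  assume "\<not> total_degree_less Q n"
  then obtain m0 where m0: "m0 \<in> ?K" "n \<le> ?deg m0"
    by (force simp: total_degree_less_def)
  define d where "d = Max (?deg ` ?K)"
  have "d \<in> ?deg ` ?K" unfolding d_def using m0 by (intro Max_in) auto
  then obtain m1 where m1: "m1 \<in> ?K" "?deg m1 = d" by auto
  have le: "?deg m \<le> d" if "m \<in> ?K" for m unfolding d_def using that by auto
  have "n \<le> d" using m0(2) le[OF m0(1)] by (rule order_trans)
  have "(\<Sum>(i, j, k)\<in>{m \<in> ?K. ?deg m = d}. ?c (i, j, k) * \<xi> ^ i * \<eta> ^ j * \<zeta> ^ k) = 0"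
    if nz: "\<xi> \<noteq> 0" "\<eta> \<noteq> 0" "\<zeta> \<noteq> 0" for \<xi> \<eta> \<zeta>
  proof -
    define h where "h = (\<lambda>\<nu>. \<nu> ^ (2 * d) *
      poly3_eval Q (\<xi> / \<nu>^2) (\<eta> / \<nu>^2 + \<nu>^2 / \<eta>) (\<zeta> / \<nu>^2))"
    have "((\<lambda>\<nu>::complex. \<nu> ^ (2 * (d - n))) \<longlongrightarrow> 0 ^ (2 * (d - n))) (at 0)"
      by (intro tendsto_intros)
    from tendsto_mult[OF this lim[OF nz]]
    have h0: "(h \<longlongrightarrow> 0) (at 0)"
      using \<open>n \<le> d\<close> by (simp add: h_def power_add[symmetric] mult.assoc[symmetric] diff_mult_distrib2)
    have lim_sum: "((\<lambda>\<nu>. \<Sum>(i, j, k)\<in>?K. ?c (i, j, k) * \<nu> ^ (2 * (d - (i + j + k))) *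
        \<xi> ^ i * (\<eta> + \<nu> ^ 4 / \<eta>) ^ j * \<zeta> ^ k) \<longlongrightarrow>
        (\<Sum>(i, j, k)\<in>?K. ?c (i, j, k) * 0 ^ (2 * (d - (i + j + k))) *
        \<xi> ^ i * (\<eta> + 0 ^ 4 / \<eta>) ^ j * \<zeta> ^ k)) (at 0)"
      unfolding case_prod_unfold by (intro tendsto_intros nz)
    have eq: "(\<Sum>(i, j, k)\<in>?K. ?c (i, j, k) * \<nu> ^ (2 * (d - (i + j + k))) *
        \<xi> ^ i * (\<eta> + \<nu> ^ 4 / \<eta>) ^ j * \<zeta> ^ k) = h \<nu>" if "\<nu> \<noteq> 0" for \<nu>
      unfolding h_def poly3_eval_def sum_distrib_left
    proof (rule sum.cong)
      fix m assume "m \<in> ?K"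
      obtain i j k where m: "m = (i, j, k)" by (cases m)
      have "2 * d = 2 * (d - (i + j + k)) + 2 * i + 2 * j + 2 * k"
        using le[OF \<open>m \<in> ?K\<close>] m by simp
      hence "\<nu> ^ (2 * d) = \<nu> ^ (2 * (d - (i + j + k))) * (\<nu>^2) ^ i * (\<nu>^2) ^ j * (\<nu>^2) ^ k"
        by (simp only: power_add power_mult)
      moreover have "(\<nu>^2) ^ i * (\<xi> / \<nu>^2) ^ i = \<xi> ^ i" "(\<nu>^2) ^ k * (\<zeta> / \<nu>^2) ^ k = \<zeta> ^ k"
        using that by (simp_all flip: power_mult_distrib)
      moreover have "(\<nu>^2) ^ j * (\<eta> / \<nu>^2 + \<nu>^2 / \<eta>) ^ j = (\<eta> + \<nu> ^ 4 / \<eta>) ^ j"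
      proof -
        have "\<nu>^2 * (\<eta> / \<nu>^2 + \<nu>^2 / \<eta>) = \<eta> + \<nu> ^ 4 / \<eta>"
          using that nz by (simp add: field_simps flip: power_add)
        thus ?thesis by (metis power_mult_distrib)
      qed
      moreover have "(e * X * Y * Z) * (c * p * q * r) = c * e * (X * p) * (Y * q) * (Z * r)"
        for e X Y Z c p q r :: complex by (simp add: mult_ac)
      ultimately have "\<nu> ^ (2 * d) * (?c m * (\<xi> / \<nu>^2) ^ i * (\<eta> / \<nu>^2 + \<nu>^2 / \<eta>) ^ j *
          (\<zeta> / \<nu>^2) ^ k) = ?c m * \<nu> ^ (2 * (d - (i + j + k))) * \<xi> ^ i * (\<eta> + \<nu> ^ 4 / \<eta>) ^ j * \<zeta> ^ k"
        by (simp only:)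
      from this[symmetric] show "(case m of (i, j, k) \<Rightarrow> ?c (i, j, k) * \<nu> ^ (2 * (d - (i + j + k))) * \<xi> ^ i *
          (\<eta> + \<nu> ^ 4 / \<eta>) ^ j * \<zeta> ^ k) = \<nu> ^ (2 * d) *
          (case m of (i, j, k) \<Rightarrow> ?c (i, j, k) * (\<xi> / \<nu>^2) ^ i * (\<eta> / \<nu>^2 + \<nu>^2 / \<eta>) ^ j *
          (\<zeta> / \<nu>^2) ^ k)"
        by (simp only: m prod.case)
    qed simp
    have "\<forall>\<^sub>F \<nu> in at 0. (\<Sum>(i, j, k)\<in>?K. ?c (i, j, k) * \<nu> ^ (2 * (d - (i + j + k))) *
        \<xi> ^ i * (\<eta> + \<nu> ^ 4 / \<eta>) ^ j * \<zeta> ^ k) = h \<nu>"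
      using eq by (simp add: eventually_at_filter)
    with lim_sum have "(h \<longlongrightarrow> (\<Sum>(i, j, k)\<in>?K. ?c (i, j, k) * 0 ^ (2 * (d - (i + j + k))) *
        \<xi> ^ i * (\<eta> + 0 ^ 4 / \<eta>) ^ j * \<zeta> ^ k)) (at 0)"
      by (rule Lim_transform_eventually)
    from tendsto_unique[OF at_neq_bot this h0] have "(\<Sum>(i, j, k)\<in>?K. ?c (i, j, k) * 0 ^ (2 * (d - (i + j + k))) *
        \<xi> ^ i * (\<eta> + 0 ^ 4 / \<eta>) ^ j * \<zeta> ^ k) = 0"
      .
    moreover have "(\<Sum>(i, j, k)\<in>{m \<in> ?K. ?deg m = d}. ?c (i, j, k) * \<xi> ^ i * \<eta> ^ j * \<zeta> ^ k) =
        (\<Sum>(i, j, k)\<in>?K. ?c (i, j, k) * 0 ^ (2 * (d - (i + j + k))) *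
        \<xi> ^ i * (\<eta> + 0 ^ 4 / \<eta>) ^ j * \<zeta> ^ k)"
    proof (rule sum.mono_neutral_cong_left)
      show "\<forall>m\<in>?K - {m \<in> ?K. ?deg m = d}. (case m of (i, j, k) \<Rightarrow>
          ?c (i, j, k) * 0 ^ (2 * (d - (i + j + k))) * \<xi> ^ i * (\<eta> + 0 ^ 4 / \<eta>) ^ j * \<zeta> ^ k) = 0"
      proof
        fix m assume m: "m \<in> ?K - {m \<in> ?K. ?deg m = d}"
        obtain i j k where ijk: "m = (i, j, k)" by (cases m)
        have "i + j + k \<noteq> d" "i + j + k \<le> d" using m le[of m] ijk by auto
        hence "0 < d - (i + j + k)" by simp
        thus "(case m of (i, j, k) \<Rightarrow> ?c (i, j, k) * 0 ^ (2 * (d - (i + j + k))) *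
            \<xi> ^ i * (\<eta> + 0 ^ 4 / \<eta>) ^ j * \<zeta> ^ k) = 0"
          unfolding ijk prod.case by (subst zero_power) simp_all
      qed
      fix m assume m: "m \<in> {m \<in> ?K. ?deg m = d}"
      obtain i j k where ijk: "m = (i, j, k)" by (cases m)
      have "d - (i + j + k) = 0" using m ijk by simp
      thus "(case m of (i, j, k) \<Rightarrow> ?c (i, j, k) * \<xi> ^ i * \<eta> ^ j * \<zeta> ^ k) =
          (case m of (i, j, k) \<Rightarrow> ?c (i, j, k) * 0 ^ (2 * (d - (i + j + k))) *
            \<xi> ^ i * (\<eta> + 0 ^ 4 / \<eta>) ^ j * \<zeta> ^ k)"
        unfolding ijk prod.case by simp
    qed simp_all
    ultimately show ?thesis by simp
  qed
  from poly3_coeffs_zero[OF _ this, of m1] have "?c m1 = 0"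
    using m1 by simp
  thus False using m1 by (simp add: in_keys_iff)
qed

section \<open>Pairs of matrices and their traces\<close>

definition mat22 :: "complex \<Rightarrow> complex \<Rightarrow> complex \<Rightarrow> complex \<Rightarrow> complex^2^2" where
  "mat22 p q r s = vector [vector [p, q], vector [r, s]]"

lemma mat22_nth [simp]:
  "mat22 p q r s $ 1 $ 1 = p" "mat22 p q r s $ 1 $ 2 = q"
  "mat22 p q r s $ 2 $ 1 = r" "mat22 p q r s $ 2 $ 2 = s"
  by (simp_all add: mat22_def)

lemma mat22_eqI:
  fixes x y :: "complex^2^2"
  assumes "x $ 1 $ 1 = y $ 1 $ 1" "x $ 1 $ 2 = y $ 1 $ 2" "x $ 2 $ 1 = y $ 2 $ 1" "x $ 2 $ 2 = y $ 2 $ 2"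
  shows "x = y"
  using assms by (simp add: vec_eq_iff forall_2)

lemma mat22_eta: "mat22 (x $ 1 $ 1) (x $ 1 $ 2) (x $ 2 $ 1) (x $ 2 $ 2) = x"
  by (rule mat22_eqI) simp_all

lemma mat22_cases:
  fixes x :: "complex^2^2"
  obtains a b c d where "x = mat22 a b c d"
  using mat22_eta by metis

lemma mat22_mult: "mat22 a b c d ** mat22 e f g h =
    mat22 (a * e + b * g) (a * f + b * h) (c * e + d * g) (c * f + d * h)"
  by (rule mat22_eqI) (simp_all add: matrix_matrix_mult_def sum_2)

lemma det_mat22: "det (mat22 a b c d) = a * d - b * c"
  by (simp add: det_2)

lemma trace_mat22: "trace (mat22 a b c d) = a + d"
  by (simp add: trace_def sum_2)

lemma mat_1_mat22: "mat 1 = mat22 1 0 0 1"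
  by (rule mat22_eqI) (simp_all add: mat_def)

definition adj22 :: "complex^2^2 \<Rightarrow> complex^2^2" where
  "adj22 x = mat22 (x $ 2 $ 2) (- (x $ 1 $ 2)) (- (x $ 2 $ 1)) (x $ 1 $ 1)"

lemma adj22_mat22: "adj22 (mat22 a b c d) = mat22 d (- b) (- c) a"
  by (simp add: adj22_def)

lemma adj22_mult: "adj22 (x ** y) = adj22 y ** adj22 x"
  by (cases x rule: mat22_cases; cases y rule: mat22_cases)
    (simp add: mat22_mult adj22_mat22 algebra_simps)

lemma adj22_adj22: "adj22 (adj22 x) = x"
  by (cases x rule: mat22_cases) (simp add: adj22_mat22)

lemma adj22_inverse:
  assumes "det x = 1"
  shows "x ** adj22 x = mat 1" "adj22 x ** x = mat 1"
  using assms by (cases x rule: mat22_cases;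
      simp add: det_mat22 adj22_mat22 mat22_mult mat_1_mat22 algebra_simps)+

lemma matrix_inv_adj22:
  assumes "det x = 1"
  shows "matrix_inv x = adj22 x"
proof -
  have "invertible x" using assms by (simp add: invertible_det_nz)
  hence "matrix_inv x ** x = mat 1"
    unfolding invertible_def matrix_inv_def by (rule someI2_ex) blast
  hence "matrix_inv x ** x ** adj22 x = adj22 x" by simp
  thus ?thesis by (simp add: adj22_inverse[OF assms] flip: matrix_mul_assoc)
qed

text \<open>
  For determinant \<open>1\<close> this is the trace function \<open>z\<close>, with the inverse matrix replaced by the
  adjugate. This makes it a polynomial in the entries, which is continuous.
\<close>

definition pair_trace :: "complex^2^2 \<Rightarrow> complex^2^2 \<Rightarrow> complex" where
  "pair_trace x1 x2 = trace (x1 ** adj22 x2)"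

lemma pair_trace_mat22:
  "pair_trace (mat22 a b c d) (mat22 e f g h) = a * h - b * g - c * f + d * e"
  by (simp add: pair_trace_def adj22_mat22 mat22_mult trace_mat22)

lemma conj_eq:
  fixes g x y :: "complex^2^2"
  assumes "det g = 1" "y ** g = g ** x"
  shows "y = g ** x ** adj22 g"
proof -
  have "y ** g ** adj22 g = g ** x ** adj22 g" using assms by simp
  thus ?thesis by (simp add: adj22_inverse[OF assms(1)] flip: matrix_mul_assoc)
qed

lemma trace_conj:
  fixes g x y :: "complex^2^2"
  assumes g: "det g = 1" and y: "y ** g = g ** x"
  shows "trace y = trace x"
proof -
  have "trace y = trace (adj22 g ** (g ** x))"
    unfolding conj_eq[OF assms] by (rule trace_mul_sym)
  thus ?thesis by (simp add: matrix_mul_assoc adj22_inverse[OF g])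
qed

lemma pair_trace_conj:
  assumes g: "det g = 1" and y1: "y1 ** g = g ** x1" and y2: "y2 ** g = g ** x2"
  shows "pair_trace y1 y2 = pair_trace x1 x2"
proof -
  have "adj22 y2 = g ** adj22 x2 ** adj22 g"
    unfolding conj_eq[OF g y2] by (simp add: adj22_mult adj22_adj22 matrix_mul_assoc)
  hence "(y1 ** adj22 y2) ** g = y1 ** (g ** adj22 x2 ** (adj22 g ** g))"
    by (simp add: matrix_mul_assoc)
  also have "\<dots> = g ** (x1 ** adj22 x2)"
    by (simp add: adj22_inverse[OF g] matrix_mul_assoc y1)
  finally show ?thesis unfolding pair_trace_def by (rule trace_conj[OF g])
qed

text \<open>
  The pairs \<open>(slice1 x, slice2 x z p)\<close> are the normal forms: the first matrix is the companion
  matrix of \<open>t\<^sup>2 - x t + 1\<close>, the second one is upper triangular with eigenvalues \<open>p\<close> and \<open>1 / p\<close>, and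
  the remaining entry is the one that makes the third trace function equal to \<open>z\<close>.
\<close>

definition slice1 :: "complex \<Rightarrow> complex^2^2" where
  "slice1 x = mat22 x (-1) 1 0"

definition slice2 :: "complex \<Rightarrow> complex \<Rightarrow> complex \<Rightarrow> complex^2^2" where
  "slice2 x z p = mat22 p (x / p - z) 0 (1 / p)"

text \<open>
  The columns of \<open>g\<close> are \<open>u\<close> and \<open>(x1 - tr x1) u\<close>, where \<open>u\<close> is \<open>v\<close> rescaled such that \<open>det g = 1\<close>; the
  hypothesis on \<open>v\<close> says that these columns are independent. In this basis \<open>x1\<close> is a companion
  matrix and \<open>x2\<close> is upper triangular, and determinant and traces fix the remaining entries.
\<close>

lemma slice_conj:
  assumes det: "det x1 = 1" "det x2 = 1"
    and v: "x2 *v v = p *s v" "det2 v (x1 *v v) \<noteq> 0"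
  obtains g where "p \<noteq> 0" "det g = 1" "x1 ** g = g ** slice1 (trace x1)"
    "x2 ** g = g ** slice2 (trace x1) (pair_trace x1 x2) p"
proof -
  obtain a b c d where x1: "x1 = mat22 a b c d" by (rule mat22_cases)
  obtain e f g h where x2: "x2 = mat22 e f g h" by (rule mat22_cases)
  define s where "s = csqrt (1 / det2 v (x1 *v v))"
  define u1 u2 where "u1 = s * v $ 1" and "u2 = s * v $ 2"
  have s: "s^2 * det2 v (x1 *v v) = 1" using v(2) by (simp add: s_def power2_csqrt)
  have d: "a * d - b * c = 1" "e * h - f * g = 1"
    using det by (simp_all add: x1 x2 det_mat22)
  have "e * v $ 1 + f * v $ 2 = p * v $ 1" "g * v $ 1 + h * v $ 2 = p * v $ 2"
    using arg_cong[OF v(1), of "\<lambda>w. w $ 1"] arg_cong[OF v(1), of "\<lambda>w. w $ 2"]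
    by (simp_all add: x2 matrix_vector_mult_def sum_2)
  hence u: "e * u1 + f * u2 = p * u1" "g * u1 + h * u2 = p * u2"
    unfolding u1_def u2_def by algebra+
  have du: "u1 * (c * u1 - a * u2) - u2 * (b * u2 - d * u1) = 1"
  proof -
    have "det2 v (x1 *v v) = v $ 1 * (c * v $ 1 + d * v $ 2) - (a * v $ 1 + b * v $ 2) * v $ 2"
      by (simp add: det2_eq x1 matrix_vector_mult_def sum_2)
    thus ?thesis using s unfolding u1_def u2_def by algebra
  qed
  have "p \<noteq> 0"
  proof
    assume "p = 0"
    hence "u1 = 0" "u2 = 0" using u d(2) by algebra+
    thus False using du by simp
  qed
  define r where "r = 1 / p"
  have pr: "p * r = 1" using \<open>p \<noteq> 0\<close> by (simp add: r_def)
  \<comment> \<open>By Cayley and Hamilton, this second column is \<open>x1 u\<close> minus the trace of \<open>x1\<close> times \<open>u\<close>, which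
    equals minus the inverse of \<open>x1\<close> applied to \<open>u\<close>.\<close>
  define w1 w2 where "w1 = b * u2 - d * u1" and "w2 = c * u1 - a * u2"
  have dw: "u1 * w2 - u2 * w1 = 1" using du by (simp add: w1_def w2_def)
  define z where "z = a * h - b * g - c * f + d * e"
  define q where "q = (a + d) * r - z"
  have lower: "u1 * (g * w1 + h * w2) - u2 * (e * w1 + f * w2) = r"
    using u d dw pr by algebra
  have upper: "(e * w1 + f * w2) * w2 - (g * w1 + h * w2) * w1 = q"
    using u d dw pr unfolding q_def z_def w1_def w2_def by algebra
  \<comment> \<open>The coordinates of a vector in the basis given by the two columns.\<close>
  have cramer: "E = (E * w2 - H * w1) * u1 + (u1 * H - u2 * E) * w1"
    "H = (E * w2 - H * w1) * u2 + (u1 * H - u2 * E) * w2" for E H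
    using dw by algebra+
  have "e * w1 + f * w2 = q * u1 + r * w1" "g * w1 + h * w2 = q * u2 + r * w2"
    using cramer(1)[of "e * w1 + f * w2" "g * w1 + h * w2"]
      cramer(2)[of "g * w1 + h * w2" "e * w1 + f * w2"] unfolding lower upper .
  hence "x2 ** mat22 u1 w1 u2 w2 = mat22 u1 w1 u2 w2 ** mat22 p q 0 r"
    using u by (simp add: x2 mat22_mult mult.commute)
  moreover have "x1 ** mat22 u1 w1 u2 w2 = mat22 u1 w1 u2 w2 ** slice1 (a + d)"
  proof -
    have "a * w1 + b * w2 = - u1" "c * w1 + d * w2 = - u2"
      using d(1) unfolding w1_def w2_def by algebra+
    thus ?thesis by (simp add: x1 slice1_def mat22_mult) (simp add: w1_def w2_def algebra_simps)
  qed
  ultimately show ?thesis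
    using \<open>p \<noteq> 0\<close> dw
    by (intro that[of "mat22 u1 w1 u2 w2"])
      (simp_all add: slice2_def x1 x2 trace_mat22 det_mat22 pair_trace_mat22 q_def r_def z_def
        mult.commute)
qed

text \<open>
  For a root \<open>p\<close> of the characteristic polynomial, the vectors \<open>(b, p - a)\<close> and \<open>(p - d, c)\<close> are
  killed by \<open>x - p\<close>. If both vanish, \<open>x\<close> is the scalar \<open>p\<close>.
\<close>

lemma eigenvector_exists:
  fixes x :: "complex^2^2"
  obtains p v where "x *v v = p *s v" "v \<noteq> 0"
proof -
  obtain a b c d where x: "x = mat22 a b c d" by (rule mat22_cases)
  define D where "D = csqrt ((a - d)^2 + 4 * b * c)"
  define p where "p = (a + d + D) / 2"
  have "D^2 = (a - d)^2 + 4 * b * c" by (simp add: D_def)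
  hence p: "(a - p) * (d - p) = b * c"
    unfolding p_def by (simp add: power2_eq_square field_simps)
  have mult: "x *v vector [s, t] = p *s vector [s, t]"
    if "a * s + b * t = p * s" "c * s + d * t = p * t" for s t
    using that by (simp add: x vec_eq_iff forall_2 matrix_vector_mult_def sum_2)
  have nz: "(vector [s, t] :: complex^2) \<noteq> 0" if "s \<noteq> 0 \<or> t \<noteq> 0" for s t
    using that by (simp add: vec_eq_iff forall_2)
  consider "b \<noteq> 0 \<or> p \<noteq> a" | "c \<noteq> 0 \<or> p \<noteq> d" | "b = 0" "p = a" "c = 0" "p = d" by blast
  thus ?thesis
  proof cases
    case 1
    have "c * b + d * (p - a) = p * (p - a)" using p by algebra
    thus ?thesis using 1 by (intro that[OF mult[of b "p - a"] nz]) (auto simp: algebra_simps)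
  next
    case 2
    have "a * (p - d) + b * c = p * (p - d)" using p by algebra
    thus ?thesis using 2 by (intro that[OF mult[of "p - d" c] nz]) (auto simp: algebra_simps)
  next
    case 3
    show ?thesis by (rule that[OF mult[of 1 0] nz]) (use 3 in auto)
  qed
qed

lemma upper_triangular_conj:
  assumes "det x2 = 1"
  obtains g a b c d p q r where "det g = 1" "x1 ** g = g ** mat22 a b c d"
    "x2 ** g = g ** mat22 p q 0 r" "p * r = 1"
proof -
  obtain p v where v: "x2 *v v = p *s v" "v \<noteq> 0" using eigenvector_exists by metis
  obtain e f g h where x2: "x2 = mat22 e f g h" by (rule mat22_cases)
  have eq: "e * v $ 1 + f * v $ 2 = p * v $ 1" "g * v $ 1 + h * v $ 2 = p * v $ 2"
    using arg_cong[OF v(1), of "\<lambda>w. w $ 1"] arg_cong[OF v(1), of "\<lambda>w. w $ 2"]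
    by (simp_all add: x2 matrix_vector_mult_def sum_2)
  have "\<exists>s t. v $ 1 * t - v $ 2 * s = 1"
  proof (cases "v $ 1 = 0")
    case True
    hence "v $ 2 \<noteq> 0" using v(2) by (simp add: vec_eq_iff forall_2)
    thus ?thesis by (intro exI[of _ "- 1 / v $ 2"] exI[of _ 0]) simp
  next
    case False
    thus ?thesis by (intro exI[of _ 0] exI[of _ "1 / v $ 1"]) simp
  qed
  then obtain s t where st: "v $ 1 * t - v $ 2 * s = 1" by blast
  define G where "G = mat22 (v $ 1) s (v $ 2) t"
  have G: "det G = 1" using st by (simp add: G_def det_mat22 mult.commute)
  have conj: "x ** G = G ** (adj22 G ** x ** G)" for x
    by (simp add: matrix_mul_assoc adj22_inverse[OF G])
  define M where "M = adj22 G ** x2 ** G"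
  have M: "M $ 2 $ 1 = 0"
    using eq st by (simp add: M_def G_def x2 mat22_mult adj22_mat22) algebra
  have "det M = 1"
    using assms G by (simp add: M_def det_mul) (simp add: G_def adj22_mat22 det_mat22 algebra_simps)
  hence "M $ 1 $ 1 * M $ 2 $ 2 = 1" using M by (simp add: det_2)
  moreover have "M = mat22 (M $ 1 $ 1) (M $ 1 $ 2) 0 (M $ 2 $ 2)"
    using mat22_eta[of M] M by simp
  moreover obtain a b c d where "adj22 G ** x1 ** G = mat22 a b c d" by (rule mat22_cases)
  ultimately show ?thesis using conj[of x1] conj[of x2] that[OF G] M_def by metis
qed

section \<open>The leading term\<close>

abbreviation twos :: "2 list \<Rightarrow> nat" where
  "twos w \<equiv> count_list w 2"

text \<open>
  Every arc of a cup or cap joins an index \<open>1\<close> to an index \<open>2\<close>.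
\<close>

lemma cup_coeff_twos: "cup_coeff n w \<noteq> 0 \<Longrightarrow> twos w = n"
proof (induction n arbitrary: w)
  case (Suc n)
  hence len: "length w = n + (2 + n)" by (auto simp: cup_coeff_def split: if_splits)
  let ?i = "w ! n" and ?j = "w ! Suc n"
  have nz: "cup_coeff n (take n w @ drop (n + 2) w) \<noteq> 0" "det2 (axis ?i 1) (axis ?j 1) \<noteq> 0"
    using Suc.prems by (auto simp: cup_coeff_Suc len)
  have "twos [?i, ?j] = 1"
    using nz(2) exhaust_2[of ?i] exhaust_2[of ?j] by (auto simp: det2_eq axis_def)
  moreover have "w = take n w @ [?i, ?j] @ drop (n + 2) w"
    using length_2_take_drop[OF len] by (metis append_take_drop_id drop_drop add.commute)
  hence "twos w = twos (take n w @ [?i, ?j] @ drop (n + 2) w)" by (rule arg_cong)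
  hence "twos w = twos (take n w @ drop (n + 2) w) + twos [?i, ?j]"
    by (simp only: count_list_append add_ac)
  ultimately show ?case using Suc.IH[OF nz(1)] by simp
qed (auto simp: cup_coeff_def split: if_splits)

lemma bracket_twos:
  assumes "bracket \<alpha> \<beta> \<gamma> w k \<noteq> 0"
  shows "twos k = twos w + \<gamma>"
proof -
  have w: "take \<beta> k @ drop (\<beta> + 2 * \<gamma>) k = w" and "twos (take (2 * \<gamma>) (drop \<beta> k)) = \<gamma>"
    using assms by (auto simp: bracket_def intro: cup_coeff_twos split: if_splits)
  moreover have "k = take \<beta> k @ take (2 * \<gamma>) (drop \<beta> k) @ drop (\<beta> + 2 * \<gamma>) k"
    by (metis append_take_drop_id drop_drop add.commute)
  hence "twos k = twos (take \<beta> k @ take (2 * \<gamma>) (drop \<beta> k) @ drop (\<beta> + 2 * \<gamma>) k)"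
    by (rule arg_cong)
  hence "twos k = twos (take \<beta> k @ drop (\<beta> + 2 * \<gamma>) k) + twos (take (2 * \<gamma>) (drop \<beta> k))"
    by (simp only: count_list_append add_ac)
  ultimately show ?thesis by simp
qed

lemma symmetrizer_basis_tensor_apply:
  assumes "length s = n"
  shows "symmetrizer n (basis_tensor s) r =
    (\<Sum>\<sigma> | \<sigma> permutes {..<n}. if r = permute_list \<sigma> s then 1 else 0) / fact n"
proof -
  have "symmetrizer n (basis_tensor s) =
      tscale (1 / fact n) (\<Sum>\<sigma> | \<sigma> permutes {..<n}. basis_tensor (permute_list \<sigma> s))"
    unfolding symmetrizer_def by (rule lin_ext_basis_tensor) (simp add: words_def assms)
  thus ?thesis by (simp add: tscale_apply sum_tensor_apply basis_tensor_apply)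
qed

lemma symmetrizer_basis_tensor_mset:
  assumes "length s = n" "symmetrizer n (basis_tensor s) r \<noteq> 0"
  shows "mset r = mset s"
proof -
  have "\<exists>\<sigma>. \<sigma> permutes {..<n} \<and> r = permute_list \<sigma> s"
  proof (rule ccontr)
    assume "\<nexists>\<sigma>. \<sigma> permutes {..<n} \<and> r = permute_list \<sigma> s"
    hence "(\<Sum>\<sigma> | \<sigma> permutes {..<n}. if r = permute_list \<sigma> s then 1 else 0 :: complex) = 0"
      by (intro sum.neutral) auto
    thus False using assms(2) by (simp add: symmetrizer_basis_tensor_apply[OF assms(1)])
  qed
  thus ?thesis using assms(1) by auto
qed

lemma sum_symmetrizer_basis_tensor:
  assumes "length s = n"
  shows "(\<Sum>r\<in>words n. symmetrizer n (basis_tensor s) r) = 1"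
proof -
  have "(\<Sum>r\<in>words n. symmetrizer n (basis_tensor s) r) =
      (\<Sum>\<sigma> | \<sigma> permutes {..<n}. \<Sum>r\<in>words n. if r = permute_list \<sigma> s then 1 else 0) / fact n"
    by (subst sum.swap) (simp add: symmetrizer_basis_tensor_apply assms sum_divide_distrib)
  also have "\<dots> = (\<Sum>\<sigma> | \<sigma> permutes {..<n}. 1) / fact n"
    using assms by (intro arg_cong[where f = "\<lambda>a. a / _"] sum.cong)
      (auto simp: finite_words words_def[symmetric], auto simp: words_def)
  also have "\<dots> = 1" by (simp add: card_permutations)
  finally show ?thesis .
qed

lemma mset_eq_twos: "mset r = mset s \<Longrightarrow> twos r = twos s"
  by (metis count_mset)

lemma prod_list_nth: "(\<Prod>i<length t. f (t ! i)) = prod_list (map f t)"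
  for f :: "2 \<Rightarrow> complex"
  by (induction t) (auto simp: prod.lessThan_Suc_shift simp del: prod.lessThan_Suc)

lemma prod_list_map_replicate: "prod_list (map f (replicate n i)) = f i ^ n"
  for f :: "2 \<Rightarrow> complex"
  by (induction n) auto

lemma prod_list_mset_cong: "mset r = mset s \<Longrightarrow> prod_list (map f r) = prod_list (map f s)"
  for f :: "2 \<Rightarrow> complex"
proof -
  assume "mset r = mset s"
  hence "prod_mset (mset (map f r)) = prod_mset (mset (map f s))" by simp
  thus ?thesis by (simp only: prod_mset_prod_list)
qed

lemma prod_power_twos: "(\<Prod>i<length t. \<nu> ^ (if t ! i = 2 then p else 0)) = \<nu> ^ (p * twos t)"
  for \<nu> :: complex
  unfolding prod_list_nth[of "\<lambda>j. \<nu> ^ (if j = 2 then p else 0)"]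
  by (induction t) (auto simp: power_add)

text \<open>
  Orders of growth that split into a row and a column part are insensitive to the permutations in
  the symmetrizer: only the number of indices \<open>2\<close> in the two words matters.
\<close>

lemma sym_action_entry_scale:
  assumes len: "length s = n" "length t = n"
    and x: "\<And>i j. \<nu>^2 * x $ i $ j = \<nu> ^ (if i = 2 then p else 0) * \<nu> ^ (if j = 2 then q else 0) * y $ i $ j"
  shows "\<nu> ^ (2 * n) * sym_action_entry n x s t =
    \<nu> ^ (p * twos t + q * twos s) * sym_action_entry n y s t"
proof -
  have "\<nu> ^ (2 * n) * (symmetrizer n (basis_tensor s) r * (\<Prod>i<n. x $ (t ! i) $ (r ! i))) =
      \<nu> ^ (p * twos t + q * twos s) *
      (symmetrizer n (basis_tensor s) r * (\<Prod>i<n. y $ (t ! i) $ (r ! i)))"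
    if r: "r \<in> words n" for r
  proof (cases "symmetrizer n (basis_tensor s) r = 0")
    case False
    hence twos: "twos r = twos s"
      using symmetrizer_basis_tensor_mset[OF len(1)] mset_eq_twos by blast
    have lr: "length r = n" using r by (simp add: words_def)
    have "\<nu> ^ (2 * n) * (\<Prod>i<n. x $ (t ! i) $ (r ! i)) = (\<Prod>i<n. \<nu>^2 * x $ (t ! i) $ (r ! i))"
      by (simp add: prod.distrib power_mult)
    also have "\<dots> = (\<Prod>i<length t. \<nu> ^ (if t ! i = 2 then p else 0)) *
        (\<Prod>i<length r. \<nu> ^ (if r ! i = 2 then q else 0)) * (\<Prod>i<n. y $ (t ! i) $ (r ! i))"
      by (simp only: x prod.distrib len lr)
    also have "\<dots> = \<nu> ^ (p * twos t + q * twos s) * (\<Prod>i<n. y $ (t ! i) $ (r ! i))"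
      by (simp only: prod_power_twos twos power_add)
    finally show ?thesis by (simp add: mult_ac)
  qed simp
  thus ?thesis unfolding sym_action_entry_def sum_distrib_left by (rule sum.cong[OF refl])
qed

lemma tendsto_sym_action_entry [tendsto_intros]:
  assumes "(x \<longlongrightarrow> y) F"
  shows "((\<lambda>u. sym_action_entry n (x u) s t) \<longlongrightarrow> sym_action_entry n y s t) F"
  unfolding sym_action_entry_def by (intro tendsto_intros assms)

lemma sym_action_entry_replicate_right:
  assumes "length s = n"
  shows "sym_action_entry n x s (replicate n i) = prod_list (map (\<lambda>j. x $ i $ j) s)"
proof -
  have "symmetrizer n (basis_tensor s) r * (\<Prod>k<n. x $ (replicate n i ! k) $ (r ! k)) =
      symmetrizer n (basis_tensor s) r * prod_list (map (\<lambda>j. x $ i $ j) s)"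
    if "r \<in> words n" for r
  proof (cases "symmetrizer n (basis_tensor s) r = 0")
    case False
    hence "mset r = mset s" by (rule symmetrizer_basis_tensor_mset[OF assms])
    hence "prod_list (map (\<lambda>j. x $ i $ j) r) = prod_list (map (\<lambda>j. x $ i $ j) s)"
      by (rule prod_list_mset_cong)
    moreover have "(\<Prod>k<n. x $ (replicate n i ! k) $ (r ! k)) = (\<Prod>k<length r. x $ i $ (r ! k))"
      using that by (intro prod.cong) (auto simp: words_def)
    ultimately show ?thesis by (simp add: prod_list_nth[of "\<lambda>j. x $ i $ j"])
  qed simp
  hence "sym_action_entry n x s (replicate n i) = (\<Sum>r\<in>words n.
      symmetrizer n (basis_tensor s) r * prod_list (map (\<lambda>j. x $ i $ j) s))"
    unfolding sym_action_entry_def by (rule sum.cong[OF refl])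
  also have "\<dots> = prod_list (map (\<lambda>j. x $ i $ j) s)"
    unfolding sum_distrib_right[symmetric] sum_symmetrizer_basis_tensor[OF assms] by simp
  finally show ?thesis .
qed

lemma symmetrizer_replicate:
  "symmetrizer n (basis_tensor (replicate n i)) = basis_tensor (replicate n i)"
proof
  fix r
  have "permute_list \<sigma> (replicate n i) = replicate n i" if "\<sigma> permutes {..<n}" for \<sigma>
    using that permutes_in_image[OF that] by (intro nth_equalityI) (simp_all add: permute_list_nth)
  hence "(\<Sum>\<sigma> | \<sigma> permutes {..<n}. if r = permute_list \<sigma> (replicate n i) then 1 else 0 :: complex) =
      (\<Sum>\<sigma> | \<sigma> permutes {..<n}. if r = replicate n i then 1 else 0)"
    by (intro sum.cong) auto
  thus "symmetrizer n (basis_tensor (replicate n i)) r = basis_tensor (replicate n i) r"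
    by (subst symmetrizer_basis_tensor_apply) (simp_all add: basis_tensor_apply card_permutations)
qed

lemma sym_action_entry_replicate_left:
  assumes "length t = n"
  shows "sym_action_entry n x (replicate n j) t = prod_list (map (\<lambda>i. x $ i $ j) t)"
proof -
  have "sym_action_entry n x (replicate n j) t =
      (\<Sum>r\<in>words n. if r = replicate n j then \<Prod>i<n. x $ (t ! i) $ (r ! i) else 0)"
    unfolding sym_action_entry_def symmetrizer_replicate
    by (rule sum.cong) (auto simp: basis_tensor_apply)
  also have "\<dots> = (\<Prod>i<n. x $ (t ! i) $ (replicate n j ! i))"
    by (simp add: finite_words) (simp add: words_def)
  also have "\<dots> = (\<Prod>i<length t. x $ (t ! i) $ j)"
    using assms by (intro prod.cong) auto
  also have "\<dots> = prod_list (map (\<lambda>i. x $ i $ j) t)"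
    by (rule prod_list_nth)
  finally show ?thesis .
qed

lemma twos_eq_0: "twos w = 0 \<Longrightarrow> w = replicate (length w) 1"
proof (induction w)
  case (Cons i w)
  thus ?case using exhaust_2[of i] by (auto split: if_splits)
qed simp

lemma twos_eq_length: "twos w = length w \<Longrightarrow> w = replicate (length w) 2"
proof (induction w)
  case (Cons i w)
  thus ?case using count_le_length[of w 2] by (auto split: if_splits)
qed simp

lemma replicate_append_nth:
  assumes "k < n"
  shows "(replicate n i @ replicate n j) ! k = i"
    and "(replicate n i @ replicate n j) ! (2 * n - 1 - k) = j"
proof -
  have "2 * n - 1 - k = n + (n - 1 - k)" "n - 1 - k < n" using assms by auto
  thus "(replicate n i @ replicate n j) ! (2 * n - 1 - k) = j"
    by (metis length_replicate nth_append_length_plus List.nth_replicate)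
qed (use assms in \<open>simp add: nth_append\<close>)

lemma cup_coeff_replicate:
  "cup_coeff n (replicate n i @ replicate n j) = det2 (axis i 1) (axis j 1) ^ n"
proof -
  have "(\<Prod>k<n. det2 (axis ((replicate n i @ replicate n j) ! k) 1)
      (axis ((replicate n i @ replicate n j) ! (2 * n - 1 - k)) 1)) =
      (\<Prod>k<n. det2 (axis i 1) (axis j 1))"
    by (rule prod.cong) (simp_all only: replicate_append_nth lessThan_iff)
  thus ?thesis by (simp add: cup_coeff_def)
qed

text \<open>
  The curve is the family of normal forms with \<open>p = \<eta> / \<nu>\<^sup>2\<close>, \<open>x = \<xi> / \<nu>\<^sup>2\<close> and \<open>z = \<zeta> / \<nu>\<^sup>2\<close>,
  conjugated by a diagonal matrix that balances the off-diagonal entries. The index \<open>2\<close> costs, in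
  powers of \<open>\<nu>\<close>, one as a row and three as a column of \<open>x1\<close>, and three as a row and one as a column
  of \<open>x2\<close>; the total cost of a term is the number \<open>e k k'\<close>. As \<open>k\<close> contains \<open>\<gamma>\<close> more indices \<open>2\<close> than
  \<open>w\<close>, and \<open>k'\<close> contains \<open>\<gamma>\<close> more than \<open>w'\<close>, the cost is at least \<open>2 * \<gamma>\<close>. Equality forces \<open>w\<close> and
  \<open>w'\<close> to consist of indices \<open>1\<close> only, the indices \<open>2\<close> of \<open>k\<close> to lie in the part of \<open>x2\<close>, and those
  of \<open>k'\<close> to lie in the part of \<open>x1\<close>, which leaves a single term.
\<close>

proposition central_function_leading_term:
  fixes \<xi> \<eta> \<zeta> :: complex
  assumes "\<eta> \<noteq> 0"
  defines "x1 \<equiv> \<lambda>\<nu>. mat22 (\<xi> / \<nu>^2) (- \<nu>) (1 / \<nu>) 0"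
    and "x2 \<equiv> \<lambda>\<nu>. mat22 (\<eta> / \<nu>^2) ((\<nu>^2 * \<xi> / \<eta> - \<zeta>) / \<nu>) 0 (\<nu>^2 / \<eta>)"
  shows "((\<lambda>\<nu>. \<nu> ^ (2 * (\<alpha> + \<beta> + \<gamma>)) *
      central_function (\<beta> + \<gamma>) (\<gamma> + \<alpha>) (\<beta> + \<alpha>) (x1 \<nu>) (x2 \<nu>)) \<longlongrightarrow>
      \<xi> ^ \<beta> * \<eta> ^ \<alpha> * \<zeta> ^ \<gamma>) (at 0)"
proof -
  let ?a = "\<beta> + \<gamma>" and ?b = "\<gamma> + \<alpha>" and ?c = "\<beta> + \<alpha>"
  define y1 where "y1 = mat22 \<xi> (- 1) 1 0"
  define y2 where "y2 = (\<lambda>\<nu>. mat22 \<eta> (\<nu>^2 * \<xi> / \<eta> - \<zeta>) 0 (1 / \<eta>))"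
  define K where "K = (\<lambda>w k k' w'. bracket \<alpha> \<beta> \<gamma> w k * bracket \<alpha> \<beta> \<gamma> w' k' *
    symmetrizer ?c (basis_tensor w') w)"
  define e where "e = (\<lambda>k k'. (1 * twos (take ?a k') + 3 * twos (take ?a k)) +
    (3 * twos (drop ?a k') + 1 * twos (drop ?a k)))"
  define S1 where "S1 = (\<lambda>x k k'. sym_action_entry ?a x (take ?a k) (take ?a k'))"
  define S2 where "S2 = (\<lambda>x k k'. sym_action_entry ?b x (drop ?a k) (drop ?a k'))"
  have twos_split: "twos k = twos (take ?a k) + twos (drop ?a k)" for k
    by (metis append_take_drop_id count_list_append)
  have K: "2 * \<gamma> \<le> e k k' \<and> (e k k' = 2 * \<gamma> \<longrightarrow> twos w = 0 \<and> twos w' = 0 \<and>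
      twos (take ?a k) = 0 \<and> twos (drop ?a k') = 0)" if "K w k k' w' \<noteq> 0" for w k k' w'
  proof -
    have "bracket \<alpha> \<beta> \<gamma> w k \<noteq> 0" "bracket \<alpha> \<beta> \<gamma> w' k' \<noteq> 0" using that by (auto simp: K_def)
    hence "twos (take ?a k) + twos (drop ?a k) = twos w + \<gamma>"
      "twos (take ?a k') + twos (drop ?a k') = twos w' + \<gamma>"
      using bracket_twos twos_split by metis+
    thus ?thesis unfolding e_def by linarith
  qed
  have y1: "\<nu>^2 * x1 \<nu> $ i $ j = \<nu> ^ (if i = 2 then 1 else 0) * \<nu> ^ (if j = 2 then 3 else 0) * y1 $ i $ j"
    and y2: "\<nu>^2 * x2 \<nu> $ i $ j = \<nu> ^ (if i = 2 then 3 else 0) * \<nu> ^ (if j = 2 then 1 else 0) * y2 \<nu> $ i $ j"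
    if "\<nu> \<noteq> 0" for \<nu> i j
    using exhaust_2[of i] exhaust_2[of j] that
    by (elim disjE; simp add: x1_def x2_def y1_def y2_def power2_eq_square power3_eq_cube)+
  have scale: "\<nu> ^ (2 * (\<alpha> + \<beta> + \<gamma>)) * (K w k k' w' * S1 (x1 \<nu>) k k' * S2 (x2 \<nu>) k k') =
      K w k k' w' * \<nu> ^ (e k k' - 2 * \<gamma>) * S1 y1 k k' * S2 (y2 \<nu>) k k'"
    if "\<nu> \<noteq> 0" "k \<in> words (?a + ?b)" "k' \<in> words (?a + ?b)" for \<nu> w k k' w'
  proof (cases "K w k k' w' = 0")
    case False
    have s1: "\<nu> ^ (2 * ?a) * S1 (x1 \<nu>) k k' =
        \<nu> ^ (1 * twos (take ?a k') + 3 * twos (take ?a k)) * S1 y1 k k'"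
      unfolding S1_def using that by (intro sym_action_entry_scale y1) (auto simp: words_def)
    have s2: "\<nu> ^ (2 * ?b) * S2 (x2 \<nu>) k k' =
        \<nu> ^ (3 * twos (drop ?a k') + 1 * twos (drop ?a k)) * S2 (y2 \<nu>) k k'"
      unfolding S2_def using that by (intro sym_action_entry_scale y2) (auto simp: words_def)
    have "2 * \<gamma> + 2 * (\<alpha> + \<beta> + \<gamma>) = 2 * ?a + 2 * ?b" by simp
    hence "\<nu> ^ (2 * \<gamma>) * \<nu> ^ (2 * (\<alpha> + \<beta> + \<gamma>)) = \<nu> ^ (2 * ?a) * \<nu> ^ (2 * ?b)"
      by (simp only: power_add[symmetric])
    moreover have "p * q = r * s \<Longrightarrow> p * (q * (u * v)) = (r * u) * (s * v)"
      for p q r s u v :: complex by algebra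
    ultimately have "\<nu> ^ (2 * \<gamma>) * (\<nu> ^ (2 * (\<alpha> + \<beta> + \<gamma>)) * (S1 (x1 \<nu>) k k' * S2 (x2 \<nu>) k k')) =
        (\<nu> ^ (2 * ?a) * S1 (x1 \<nu>) k k') * (\<nu> ^ (2 * ?b) * S2 (x2 \<nu>) k k')"
      by blast
    also have "\<dots> = \<nu> ^ e k k' * (S1 y1 k k' * S2 (y2 \<nu>) k k')"
      unfolding s1 s2 e_def power_add by (simp only: mult_ac)
    also have "\<nu> ^ e k k' = \<nu> ^ (2 * \<gamma>) * \<nu> ^ (e k k' - 2 * \<gamma>)"
      using K[OF False] by (simp flip: power_add)
    finally have "\<nu> ^ (2 * (\<alpha> + \<beta> + \<gamma>)) * (S1 (x1 \<nu>) k k' * S2 (x2 \<nu>) k k') =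
        \<nu> ^ (e k k' - 2 * \<gamma>) * (S1 y1 k k' * S2 (y2 \<nu>) k k')"
      using that(1) by (simp add: mult.assoc)
    moreover have "p * (u * v) = q * (r * s) \<Longrightarrow> p * (c * u * v) = c * q * r * s"
      for p q r s u v c :: complex by algebra
    ultimately show ?thesis by blast
  qed simp
  define R where "R = (\<lambda>\<nu>. \<Sum>w\<in>words ?c. \<Sum>k\<in>words (?a + ?b). \<Sum>k'\<in>words (?a + ?b). \<Sum>w'\<in>words ?c.
      K w k k' w' * \<nu> ^ (e k k' - 2 * \<gamma>) * S1 y1 k k' * S2 (y2 \<nu>) k k')"
  have "\<nu> ^ (2 * (\<alpha> + \<beta> + \<gamma>)) * central_function ?a ?b ?c (x1 \<nu>) (x2 \<nu>) = R \<nu>"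
    if "\<nu> \<noteq> 0" for \<nu>
    unfolding central_function_state_sum R_def sum_distrib_left
    using scale[OF that] by (intro sum.cong refl) (simp only: K_def S1_def S2_def)
  hence ev: "\<forall>\<^sub>F \<nu> in at 0. R \<nu> =
      \<nu> ^ (2 * (\<alpha> + \<beta> + \<gamma>)) * central_function ?a ?b ?c (x1 \<nu>) (x2 \<nu>)"
    by (simp add: eventually_at_filter)
  have lim: "(R \<longlongrightarrow> R 0) (at 0)"
  proof -
    have "((\<lambda>\<nu>. y2 \<nu> $ i $ j) \<longlongrightarrow> y2 0 $ i $ j) (at 0)" for i j
      using exhaust_2[of i] exhaust_2[of j]
      by (elim disjE; simp add: y2_def) (auto intro!: tendsto_eq_intros simp: assms)
    hence "(y2 \<longlongrightarrow> y2 0) (at 0)" by (intro vec_tendstoI)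
    thus ?thesis unfolding R_def S1_def S2_def by (intro tendsto_intros)
  qed
  have R0: "R 0 = \<xi> ^ \<beta> * \<eta> ^ \<alpha> * \<zeta> ^ \<gamma>"
  proof -
    define w0 :: "2 list" where "w0 = replicate ?c 1"
    define k0 :: "2 list" where
      "k0 = replicate \<beta> 1 @ (replicate \<gamma> 1 @ replicate \<gamma> 2) @ replicate \<alpha> 1"
    define k1 :: "2 list" where
      "k1 = replicate \<beta> 1 @ (replicate \<gamma> 2 @ replicate \<gamma> 1) @ replicate \<alpha> 1"
    have split0: "take ?a k0 = replicate ?a 1" "drop ?a k0 = replicate \<gamma> 2 @ replicate \<alpha> 1"
      by (simp_all add: k0_def replicate_add)
    have split1: "take ?a k1 = replicate \<beta> 1 @ replicate \<gamma> 2" "drop ?a k1 = replicate ?b 1"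
      by (simp_all add: k1_def replicate_add)
    have mid: "take \<beta> k @ drop (\<beta> + 2 * \<gamma>) k = w0 \<Longrightarrow> length k = \<beta> + (2 * \<gamma> + \<alpha>) \<Longrightarrow>
        k = replicate \<beta> 1 @ take (2 * \<gamma>) (drop \<beta> k) @ replicate \<alpha> 1" for k
    proof -
      assume w: "take \<beta> k @ drop (\<beta> + 2 * \<gamma>) k = w0" and len: "length k = \<beta> + (2 * \<gamma> + \<alpha>)"
      have "take \<beta> k = replicate \<beta> 1" "drop (\<beta> + 2 * \<gamma>) k = replicate \<alpha> 1"
        using w len unfolding w0_def replicate_add by auto
      thus ?thesis by (metis append_take_drop_id drop_drop add.commute)
    qed
    \<comment> \<open>Around the centre, \<open>k0\<close> reads \<open>1\<close> on the left and \<open>2\<close> on the right of each arc, \<open>k1\<close> the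
      other way round.\<close>
    have unique: "w = w0 \<and> w' = w0 \<and> k = k0 \<and> k' = k1"
      if "K w k k' w' \<noteq> 0" "e k k' = 2 * \<gamma>" "w \<in> words ?c" "w' \<in> words ?c" for w k k' w'
    proof -
      have z: "twos w = 0" "twos w' = 0" "twos (take ?a k) = 0" "twos (drop ?a k') = 0"
        using K[OF that(1)] that(2) by auto
      hence w: "w = w0" "w' = w0"
        using twos_eq_0[of w] twos_eq_0[of w'] that(3,4) by (auto simp: words_def w0_def)
      have b: "bracket \<alpha> \<beta> \<gamma> w0 k \<noteq> 0" "bracket \<alpha> \<beta> \<gamma> w0 k' \<noteq> 0"
        using that(1) w by (auto simp: K_def)
      hence len: "length k = \<beta> + (2 * \<gamma> + \<alpha>)" "length k' = \<beta> + (2 * \<gamma> + \<alpha>)"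
        and rest: "take \<beta> k @ drop (\<beta> + 2 * \<gamma>) k = w0" "take \<beta> k' @ drop (\<beta> + 2 * \<gamma>) k' = w0"
        by (auto simp: bracket_def split: if_splits)
      define m m' where "m = take (2 * \<gamma>) (drop \<beta> k)" and "m' = take (2 * \<gamma>) (drop \<beta> k')"
      have k: "k = replicate \<beta> 1 @ m @ replicate \<alpha> 1" "k' = replicate \<beta> 1 @ m' @ replicate \<alpha> 1"
        unfolding m_def m'_def by (rule mid[OF rest(1) len(1)], rule mid[OF rest(2) len(2)])
      have lm: "length m = 2 * \<gamma>" "length m' = 2 * \<gamma>" using len by (auto simp: m_def m'_def)
      have tm: "twos m = \<gamma>" "twos m' = \<gamma>"
        using bracket_twos[OF b(1)] bracket_twos[OF b(2)] z w
        by (auto simp: k count_list_append count_list_0_iff)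
      have "twos (take \<gamma> m) = 0" "twos (drop \<gamma> m') = 0"
        using z(3,4) lm by (auto simp: k count_list_append count_list_0_iff)
      moreover have "twos m = twos (take \<gamma> m) + twos (drop \<gamma> m)"
        "twos m' = twos (take \<gamma> m') + twos (drop \<gamma> m')"
        by (metis append_take_drop_id count_list_append)+
      ultimately have "take \<gamma> m = replicate \<gamma> 1" "drop \<gamma> m = replicate \<gamma> 2"
        "take \<gamma> m' = replicate \<gamma> 2" "drop \<gamma> m' = replicate \<gamma> 1"
        using twos_eq_0[of "take \<gamma> m"] twos_eq_length[of "drop \<gamma> m"]
          twos_eq_length[of "take \<gamma> m'"] twos_eq_0[of "drop \<gamma> m'"] lm tm by auto
      hence "m = replicate \<gamma> 1 @ replicate \<gamma> 2" "m' = replicate \<gamma> 2 @ replicate \<gamma> 1"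
        by (metis append_take_drop_id)+
      thus ?thesis using w k by (simp add: k0_def k1_def)
    qed
    have "bracket \<alpha> \<beta> \<gamma> w0 k0 = 1" "bracket \<alpha> \<beta> \<gamma> w0 k1 = (- 1) ^ \<gamma>"
      by (simp_all add: bracket_def k0_def k1_def w0_def cup_coeff_replicate det2_eq axis_def
          replicate_add)
    \<comment> \<open>The sign comes from the \<open>\<gamma>\<close> reversed arcs of \<open>k1\<close>; it cancels against the signs of the
      \<open>\<gamma>\<close> entries \<open>- \<zeta>\<close> of \<open>y2 0\<close>.\<close>
    hence K0: "K w0 k0 k1 w0 = (- 1) ^ \<gamma>"
      by (simp add: K_def w0_def symmetrizer_replicate basis_tensor_apply)
    have e0: "e k0 k1 = 2 * \<gamma>"
    proof -
      have "twos (replicate n 2) = n" "twos (replicate n 1) = 0" for n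
        by (induction n) auto
      thus ?thesis by (simp only: e_def split0 split1 count_list_append) simp
    qed
    have S0: "S1 y1 k0 k1 = \<xi> ^ \<beta>" "S2 (y2 0) k0 k1 = (- \<zeta>) ^ \<gamma> * \<eta> ^ \<alpha>"
      by (simp_all add: S1_def S2_def split0 split1 sym_action_entry_replicate_left
          sym_action_entry_replicate_right prod_list_map_replicate y1_def y2_def)
    have "R 0 = (\<Sum>w\<in>words ?c. \<Sum>k\<in>words (?a + ?b). \<Sum>k'\<in>words (?a + ?b). \<Sum>w'\<in>words ?c.
        if w' = w0 then if k' = k1 then if k = k0 then if w = w0 then
          K w0 k0 k1 w0 * S1 y1 k0 k1 * S2 (y2 0) k0 k1 else 0 else 0 else 0 else 0)"
      unfolding R_def
    proof (intro sum.cong refl)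
      fix w k k' w' assume "w \<in> words ?c" "w' \<in> words ?c"
      hence "w = w0 \<and> w' = w0 \<and> k = k0 \<and> k' = k1"
        if "K w k k' w' * 0 ^ (e k k' - 2 * \<gamma>) \<noteq> 0"
        using unique[of w k k' w'] K[of w k k' w'] that by (auto simp: power_0_left split: if_splits)
      thus "K w k k' w' * 0 ^ (e k k' - 2 * \<gamma>) * S1 y1 k k' * S2 (y2 0) k k' =
          (if w' = w0 then if k' = k1 then if k = k0 then if w = w0 then
            K w0 k0 k1 w0 * S1 y1 k0 k1 * S2 (y2 0) k0 k1 else 0 else 0 else 0 else 0)"
        by (cases "K w k k' w' * 0 ^ (e k k' - 2 * \<gamma>) = 0") (auto simp: e0)
    qed
    also have "\<dots> = K w0 k0 k1 w0 * S1 y1 k0 k1 * S2 (y2 0) k0 k1"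
    proof -
      have "w0 \<in> words ?c" "k0 \<in> words (?a + ?b)" "k1 \<in> words (?a + ?b)"
        by (simp_all add: w0_def k0_def k1_def words_def)
      thus ?thesis by (simp add: finite_words)
    qed
    also have "\<dots> = \<xi> ^ \<beta> * \<eta> ^ \<alpha> * \<zeta> ^ \<gamma>"
    proof -
      have *: "\<zeta> ^ \<gamma> = (- 1) ^ \<gamma> * (- \<zeta>) ^ \<gamma>" by (simp flip: power_mult_distrib)
      show ?thesis unfolding K0 S0 * by (simp only: mult_ac)
    qed
    finally show ?thesis .
  qed
  show ?thesis
    using Lim_transform_eventually[OF lim ev] unfolding R0 .
qed

section \<open>Central functions as polynomials in the traces\<close>

text \<open>
  Functions of \<open>x\<close>, \<open>z\<close> and \<open>p \<noteq> 0\<close> in the module spanned by \<open>1\<close> and \<open>p\<close> over the polynomials in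
  \<open>x\<close>, \<open>y = p + 1 / p\<close> and \<open>z\<close>. They form a ring, since \<open>p\<^sup>2 = y p - 1\<close>; it contains
  \<open>1 / p = y - p\<close> and therefore all entries of the normal forms.
\<close>

definition half_poly :: "(complex \<Rightarrow> complex \<Rightarrow> complex \<Rightarrow> complex) \<Rightarrow> bool" where
  "half_poly h \<longleftrightarrow> (\<exists>A B. poly_function A \<and> poly_function B \<and>
     (\<forall>x z p. p \<noteq> 0 \<longrightarrow> h x z p = A x (p + 1 / p) z + p * B x (p + 1 / p) z))"

lemma half_polyI:
  assumes "poly_function A" "poly_function B"
    and "\<And>x z p. p \<noteq> 0 \<Longrightarrow> h x z p = A x (p + 1 / p) z + p * B x (p + 1 / p) z"
  shows "half_poly h"
  using assms unfolding half_poly_def by blast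

lemma half_polyE:
  assumes "half_poly h"
  obtains A B where "poly_function A" "poly_function B"
    "\<And>x z p. p \<noteq> 0 \<Longrightarrow> h x z p = A x (p + 1 / p) z + p * B x (p + 1 / p) z"
  using assms unfolding half_poly_def by blast

lemma half_poly_const: "half_poly (\<lambda>x z p. c)"
  by (rule half_polyI[OF poly_function_const[of c] poly_function_const[of 0]]) simp

lemma half_poly_x: "half_poly (\<lambda>x z p. x)"
  by (rule half_polyI[OF poly_function_vars(1) poly_function_const[of 0]]) simp

lemma half_poly_z: "half_poly (\<lambda>x z p. z)"
  by (rule half_polyI[OF poly_function_vars(3) poly_function_const[of 0]]) simp

lemma half_poly_p: "half_poly (\<lambda>x z p. p)"
  by (rule half_polyI[OF poly_function_const[of 0] poly_function_const[of 1]]) simp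

lemma half_poly_inverse_p: "half_poly (\<lambda>x z p. 1 / p)"
  by (rule half_polyI[OF poly_function_vars(2) poly_function_const[of "- 1"]]) simp

lemma half_poly_add:
  assumes "half_poly h" "half_poly h'"
  shows "half_poly (\<lambda>x z p. h x z p + h' x z p)"
proof -
  obtain A B where 1: "poly_function A" "poly_function B"
    "\<And>x z p. p \<noteq> 0 \<Longrightarrow> h x z p = A x (p + 1 / p) z + p * B x (p + 1 / p) z"
    using half_polyE[OF assms(1)] by blast
  obtain A' B' where 2: "poly_function A'" "poly_function B'"
    "\<And>x z p. p \<noteq> 0 \<Longrightarrow> h' x z p = A' x (p + 1 / p) z + p * B' x (p + 1 / p) z"
    using half_polyE[OF assms(2)] by blast
  show ?thesis
    by (rule half_polyI[OF poly_function_add[OF 1(1) 2(1)] poly_function_add[OF 1(2) 2(2)]])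
      (simp add: 1 2 algebra_simps)
qed

lemma half_poly_mult:
  assumes "half_poly h" "half_poly h'"
  shows "half_poly (\<lambda>x z p. h x z p * h' x z p)"
proof -
  obtain A B where 1: "poly_function A" "poly_function B"
    "\<And>x z p. p \<noteq> 0 \<Longrightarrow> h x z p = A x (p + 1 / p) z + p * B x (p + 1 / p) z"
    using half_polyE[OF assms(1)] by blast
  obtain A' B' where 2: "poly_function A'" "poly_function B'"
    "\<And>x z p. p \<noteq> 0 \<Longrightarrow> h' x z p = A' x (p + 1 / p) z + p * B' x (p + 1 / p) z"
    using half_polyE[OF assms(2)] by blast
  have AA: "poly_function (\<lambda>x y z. A x y z * A' x y z + (- 1) * (B x y z * B' x y z))"
    by (intro poly_function_add poly_function_mult poly_function_const 1(1,2) 2(1,2))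
  have BB: "poly_function
      (\<lambda>x y z. A x y z * B' x y z + (A' x y z * B x y z + y * (B x y z * B' x y z)))"
    by (intro poly_function_add poly_function_mult poly_function_vars 1(1,2) 2(1,2))
  have eq: "(u + p * v) * (u' + p * v') =
      (u * u' + (- 1) * (v * v')) + p * (u * v' + (u' * v + (p + 1 / p) * (v * v')))"
    if "p \<noteq> 0" for p u v u' v' :: complex
    using that by (simp add: field_simps)
  show ?thesis
  proof (rule half_polyI[OF AA BB])
    fix x z p :: complex assume p: "p \<noteq> 0"
    show "h x z p * h' x z p =
        (A x (p + 1 / p) z * A' x (p + 1 / p) z + (- 1) * (B x (p + 1 / p) z * B' x (p + 1 / p) z)) +
        p * (A x (p + 1 / p) z * B' x (p + 1 / p) z + (A' x (p + 1 / p) z * B x (p + 1 / p) z +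
          (p + 1 / p) * (B x (p + 1 / p) z * B' x (p + 1 / p) z)))"
      unfolding 1(3)[OF p] 2(3)[OF p] by (rule eq[OF p])
  qed
qed

lemma half_poly_sum:
  "(\<And>i. i \<in> I \<Longrightarrow> half_poly (h i)) \<Longrightarrow> half_poly (\<lambda>x z p. \<Sum>i\<in>I. h i x z p)"
  by (induction I rule: infinite_finite_induct) (simp_all add: half_poly_const half_poly_add)

lemma half_poly_prod:
  "(\<And>i. i \<in> I \<Longrightarrow> half_poly (h i)) \<Longrightarrow> half_poly (\<lambda>x z p. \<Prod>i\<in>I. h i x z p)"
  by (induction I rule: infinite_finite_induct) (simp_all add: half_poly_const half_poly_mult)

lemma half_poly_slice1: "half_poly (\<lambda>x z p. slice1 x $ i $ j)"
  using exhaust_2[of i] exhaust_2[of j]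
  by (elim disjE; simp add: slice1_def half_poly_const half_poly_x)

lemma half_poly_slice2: "half_poly (\<lambda>x z p. slice2 x z p $ i $ j)"
proof -
  have "half_poly (\<lambda>x z p. x * (1 / p) + (- 1) * z)"
    by (intro half_poly_add half_poly_mult half_poly_x half_poly_inverse_p half_poly_const half_poly_z)
  hence "half_poly (\<lambda>x z p. x / p - z)" by simp
  thus ?thesis
    using exhaust_2[of i] exhaust_2[of j]
    by (elim disjE; simp add: slice2_def half_poly_const half_poly_p half_poly_inverse_p)
qed

lemma half_poly_central_function:
  "half_poly (\<lambda>x z p.
     central_function (\<beta> + \<gamma>) (\<gamma> + \<alpha>) (\<beta> + \<alpha>) (slice1 x) (slice2 x z p))"
  unfolding central_function_state_sum sym_action_entry_def
  by (intro half_poly_sum half_poly_prod half_poly_mult half_poly_const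
      half_poly_slice1 half_poly_slice2)

lemma tendsto_central_function:
  assumes "(x1 \<longlongrightarrow> y1) F" "(x2 \<longlongrightarrow> y2) F"
  shows "((\<lambda>u. central_function (\<beta> + \<gamma>) (\<gamma> + \<alpha>) (\<beta> + \<alpha>) (x1 u) (x2 u)) \<longlongrightarrow>
    central_function (\<beta> + \<gamma>) (\<gamma> + \<alpha>) (\<beta> + \<alpha>) y1 y2) F"
  unfolding central_function_state_sum by (intro tendsto_intros assms)

lemma tendsto_mat22 [tendsto_intros]:
  assumes "(a \<longlongrightarrow> a') F" "(b \<longlongrightarrow> b') F" "(c \<longlongrightarrow> c') F" "(d \<longlongrightarrow> d') F"
  shows "((\<lambda>u. mat22 (a u) (b u) (c u) (d u)) \<longlongrightarrow> mat22 a' b' c' d') F"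
proof (intro vec_tendstoI)
  fix i j :: 2
  show "((\<lambda>u. mat22 (a u) (b u) (c u) (d u) $ i $ j) \<longlongrightarrow> mat22 a' b' c' d' $ i $ j) F"
    using exhaust_2[of i] exhaust_2[of j] assms by (elim disjE; simp)
qed

lemma tendsto_poly_function:
  assumes "poly_function A" "(f \<longlongrightarrow> x) F" "(g \<longlongrightarrow> y) F" "(h \<longlongrightarrow> z) F"
  shows "((\<lambda>u. A (f u) (g u) (h u)) \<longlongrightarrow> A x y z) F"
proof -
  obtain P where "A = poly3_eval P" using assms(1) by (auto simp: poly_function_def fun_eq_iff)
  thus ?thesis unfolding poly3_eval_def case_prod_unfold
    by (simp only:) (intro tendsto_intros assms)
qed

lemma eventually_not_in_finite:
  "finite S \<Longrightarrow> \<forall>\<^sub>F t in at (0 :: complex). t \<notin> S"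
  using islimpt_finite islimpt_iff_eventually by blast

text \<open>
  The generic pairs of \<open>step1\<close> have an upper triangular \<open>x2\<close> with distinct eigenvalues \<open>p\<close>, \<open>r\<close>,
  neither of whose eigenvectors is an eigenvector of \<open>x1\<close>; comparing the two normal forms removes
  \<open>B\<close>. The next three steps drop the genericity conditions one by one, each by a perturbation
  within the pairs of matrices of determinant \<open>1\<close>, and every pair is conjugate to one of the
  resulting form.
\<close>

proposition central_function_poly_function:
  obtains A where "poly_function A"
    and "\<And>x1 x2. det x1 = 1 \<Longrightarrow> det x2 = 1 \<Longrightarrow>
      central_function (\<beta> + \<gamma>) (\<gamma> + \<alpha>) (\<beta> + \<alpha>) x1 x2 = A (trace x1) (trace x2) (pair_trace x1 x2)"
proof -
  let ?\<chi> = "central_function (\<beta> + \<gamma>) (\<gamma> + \<alpha>) (\<beta> + \<alpha>)"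
  from half_poly_central_function[of \<beta> \<gamma> \<alpha>, unfolded half_poly_def]
  obtain A B where *: "poly_function A \<and> poly_function B \<and> (\<forall>x z p. p \<noteq> 0 \<longrightarrow>
      ?\<chi> (slice1 x) (slice2 x z p) = A x (p + 1 / p) z + p * B x (p + 1 / p) z)"
    by (elim exE)
  hence A: "poly_function A" by (rule conjunct1)
  have AB: "?\<chi> (slice1 x) (slice2 x z p) = A x (p + 1 / p) z + p * B x (p + 1 / p) z"
    if "p \<noteq> 0" for x z p
    using * that by simp
  define good where "good x1 x2 \<longleftrightarrow> ?\<chi> x1 x2 = A (trace x1) (trace x2) (pair_trace x1 x2)" for x1 x2
  have limit: "good y1 y2"
    if lim: "(x1 \<longlongrightarrow> y1) (at 0)" "(x2 \<longlongrightarrow> y2) (at 0)"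
      and ev: "\<forall>\<^sub>F t in at 0. good (x1 t) (x2 t)"
    for x1 x2 :: "complex \<Rightarrow> complex^2^2" and y1 y2
  proof -
    have "((\<lambda>t. A (trace (x1 t)) (trace (x2 t)) (pair_trace (x1 t) (x2 t))) \<longlongrightarrow>
        A (trace y1) (trace y2) (pair_trace y1 y2)) (at 0)"
      unfolding pair_trace_def adj22_def trace_def matrix_matrix_mult_def sum_2 vec_lambda_beta
      by (intro tendsto_poly_function[OF A] tendsto_intros lim)
    moreover have "\<forall>\<^sub>F t in at 0. A (trace (x1 t)) (trace (x2 t)) (pair_trace (x1 t) (x2 t)) =
        ?\<chi> (x1 t) (x2 t)"
      using ev unfolding good_def by (rule eventually_mono) simp
    ultimately have "((\<lambda>t. ?\<chi> (x1 t) (x2 t)) \<longlongrightarrow>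
        A (trace y1) (trace y2) (pair_trace y1 y2)) (at 0)"
      by (rule Lim_transform_eventually)
    from tendsto_unique[OF at_neq_bot tendsto_central_function[OF lim] this]
    show ?thesis unfolding good_def .
  qed
  have slice: "?\<chi> x1 x2 = A (trace x1) (p + 1 / p) (pair_trace x1 x2) +
      p * B (trace x1) (p + 1 / p) (pair_trace x1 x2)"
    if "det x1 = 1" "det x2 = 1" "x2 *v v = p *s v" "det2 v (x1 *v v) \<noteq> 0" for x1 x2 p v
  proof -
    from slice_conj[OF that] obtain g where "p \<noteq> 0" "det g = 1" "x1 ** g = g ** slice1 (trace x1)"
      "x2 ** g = g ** slice2 (trace x1) (pair_trace x1 x2) p" .
    thus ?thesis by (simp add: central_function_conjugation[of g] AB)
  qed
  have step1: "good (mat22 a b c d) (mat22 p q 0 r)"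
    if d: "a * d - b * c = 1" and pr: "p * r = 1" "p \<noteq> r"
      and c: "c \<noteq> 0" "c * q^2 + (d - a) * (r - p) * q - b * (r - p)^2 \<noteq> 0" for a b c d p q r
  proof -
    let ?x1 = "mat22 a b c d" and ?x2 = "mat22 p q 0 r"
    have det: "det ?x1 = 1" "det ?x2 = 1" using d pr by (simp_all add: det_mat22)
    have "p \<noteq> 0" "r \<noteq> 0" using pr(1) by auto
    hence r: "r = 1 / p" "p = 1 / r" using pr(1) by (simp_all add: field_simps)
    have y: "p + 1 / p = trace ?x2" "r + 1 / r = trace ?x2"
      unfolding trace_mat22 r(1)[symmetric] r(2)[symmetric] by (rule refl add.commute)+
    \<comment> \<open>The second condition in \<open>c\<close> says that \<open>v\<close>, the eigenvector for \<open>r\<close>, is not an eigenvector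
      of \<open>x1\<close>; for \<open>u\<close> this is the first one.\<close>
    define u v :: "complex^2" where "u = vector [1, 0]" and "v = vector [q, r - p]"
    have "?x2 *v u = p *s u" "?x2 *v v = r *s v"
      by (simp_all add: u_def v_def vec_eq_iff forall_2 matrix_vector_mult_def sum_2 algebra_simps)
    moreover have "det2 u (?x1 *v u) \<noteq> 0" "det2 v (?x1 *v v) \<noteq> 0"
      using c by (simp_all add: u_def v_def det2_eq matrix_vector_mult_def sum_2 power2_eq_square
          algebra_simps)
    ultimately have eqs:
      "?\<chi> ?x1 ?x2 = A (trace ?x1) (trace ?x2) (pair_trace ?x1 ?x2) +
        p * B (trace ?x1) (trace ?x2) (pair_trace ?x1 ?x2)"
      "?\<chi> ?x1 ?x2 = A (trace ?x1) (trace ?x2) (pair_trace ?x1 ?x2) +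
        r * B (trace ?x1) (trace ?x2) (pair_trace ?x1 ?x2)"
      using slice[OF det, of u p] slice[OF det, of v r] unfolding y by blast+
    hence "B (trace ?x1) (trace ?x2) (pair_trace ?x1 ?x2) = 0"
      using pr(2) by simp
    thus ?thesis using eqs(1) by (simp add: good_def)
  qed
  have step2: "good (mat22 a b c d) (mat22 p q 0 r)"
    if d: "a * d - b * c = 1" and pr: "p * r = 1" "p \<noteq> r" and c: "c \<noteq> 0" for a b c d p q r
  proof (rule limit)
    \<comment> \<open>The expression of \<open>step1\<close> is a nonzero polynomial in the upper right entry of \<open>x2\<close>.\<close>
    define P where "P = [:- b * (r - p)^2, (d - a) * (r - p), c:]"
    have "P \<noteq> 0" using c by (simp add: P_def)
    hence "finite {s. poly P s = 0}" by (rule poly_roots_finite)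
    hence "finite ((\<lambda>s. s - q) ` {s. poly P s = 0})" by simp
    from eventually_not_in_finite[OF this]
    show "\<forall>\<^sub>F t in at 0. good (mat22 a b c d) (mat22 p (q + t) 0 r)"
    proof (rule eventually_mono)
      fix t assume "t \<notin> (\<lambda>s. s - q) ` {s. poly P s = 0}"
      hence "poly P (q + t) \<noteq> 0" by force
      moreover have "poly P (q + t) =
          c * (q + t)^2 + (d - a) * (r - p) * (q + t) - b * (r - p)^2"
        by (simp add: P_def power2_eq_square algebra_simps)
      ultimately show "good (mat22 a b c d) (mat22 p (q + t) 0 r)"
        by (intro step1 d pr c) simp
    qed
    have "((\<lambda>t. mat22 p (q + t) 0 r) \<longlongrightarrow> mat22 p (q + 0) 0 r) (at 0)"
      by (intro tendsto_intros)
    thus "((\<lambda>t. mat22 p (q + t) 0 r) \<longlongrightarrow> mat22 p q 0 r) (at 0)" by simp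
  qed (rule tendsto_const)
  have step3: "good (mat22 a b c d) (mat22 p q 0 r)"
    if d: "a * d - b * c = 1" and pr: "p * r = 1" "p \<noteq> r" for a b c d p q r
  proof (cases "c = 0")
    case True
    show ?thesis
    proof (rule limit)
      have "a * d = 1" using d True by simp
      show "\<forall>\<^sub>F t in at 0. good (mat22 (a + b * t) b (d * t) d) (mat22 p q 0 r)"
      proof (rule eventually_mono[OF eventually_not_in_finite[of "{0}"]])
        fix t :: complex assume "t \<notin> {0}"
        thus "good (mat22 (a + b * t) b (d * t) d) (mat22 p q 0 r)"
          using \<open>a * d = 1\<close> by (intro step2 pr) (auto simp: algebra_simps)
      qed simp
      have "((\<lambda>t. mat22 (a + b * t) b (d * t) d) \<longlongrightarrow> mat22 (a + b * 0) b (d * 0) d) (at 0)"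
        by (intro tendsto_intros)
      thus "((\<lambda>t. mat22 (a + b * t) b (d * t) d) \<longlongrightarrow> mat22 a b c d) (at 0)"
        by (simp add: True)
    qed (rule tendsto_const)
  qed (rule step2[OF d pr])
  have step4: "good (mat22 a b c d) (mat22 p q 0 r)"
    if d: "a * d - b * c = 1" and pr: "p * r = 1" for a b c d p q r
  proof (cases "p = r")
    case True
    show ?thesis
    proof (rule limit)
      show "\<forall>\<^sub>F t in at 0. good (mat22 a b c d) (mat22 (p * (1 + t)) q 0 (r / (1 + t)))"
      proof (rule eventually_mono[OF eventually_not_in_finite[of "{0, -1, -2}"]])
        fix t :: complex assume t: "t \<notin> {0, -1, -2}"
        have nz: "1 + t \<noteq> 0" using t by (metis insertCI add.commute add_eq_0_iff)
        have "p * (1 + t) \<noteq> r / (1 + t)"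
        proof
          assume "p * (1 + t) = r / (1 + t)"
          hence "p * ((1 + t) * (1 + t)) = p" using nz True by (simp add: field_simps)
          moreover have "p \<noteq> 0" using pr by auto
          ultimately have "(1 + t) * (1 + t) = 1" by simp
          hence "t * (t + 2) = 0" by (simp add: algebra_simps)
          hence "t = 0 \<or> t = - 2" by (simp add: eq_neg_iff_add_eq_0)
          thus False using t by blast
        qed
        thus "good (mat22 a b c d) (mat22 (p * (1 + t)) q 0 (r / (1 + t)))"
          using nz pr by (intro step3 d) simp_all
      qed simp
      have "((\<lambda>t. mat22 (p * (1 + t)) q 0 (r / (1 + t))) \<longlongrightarrow>
          mat22 (p * (1 + 0)) q 0 (r / (1 + 0))) (at 0)"
        by (intro tendsto_intros) simp
      thus "((\<lambda>t. mat22 (p * (1 + t)) q 0 (r / (1 + t))) \<longlongrightarrow> mat22 p q 0 r) (at 0)" by simp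
    qed (rule tendsto_const)
  qed (rule step3[OF d pr])
  have "good x1 x2" if det: "det x1 = 1" "det x2 = 1" for x1 x2
  proof -
    from upper_triangular_conj[OF det(2), of x1] obtain g a b c d p q r where
      g: "det g = 1" "x1 ** g = g ** mat22 a b c d" "x2 ** g = g ** mat22 p q 0 r" and pr: "p * r = 1" .
    have "det (x1 ** g) = det (g ** mat22 a b c d)" by (simp add: g)
    hence "a * d - b * c = 1" using g(1) det by (simp add: det_mul det_mat22)
    from step4[OF this pr, of q] show ?thesis
      unfolding good_def central_function_conjugation[OF g] trace_conj[OF g(1,2)]
        trace_conj[OF g(1,3)] pair_trace_conj[OF g] .
  qed
  thus ?thesis using that[OF A] unfolding good_def by blast
qed

theorem proposition5p8:
  fixes a b c \<alpha> \<beta> \<gamma> :: nat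
  assumes "admissible a b c"
    and "real \<alpha> = alpha a b c" and "real \<beta> = beta a b c" and "real \<gamma> = gamma a b c"
  shows "(\<exists>!p. expressed_by (central_function a b c) p) \<and>
    (\<forall>p. expressed_by (central_function a b c) p \<longrightarrow>
      total_degree_less (p - poly3_monom \<beta> \<alpha> \<gamma>) (\<alpha> + \<beta> + \<gamma>))"
proof -
  have "real a = real (\<beta> + \<gamma>)" "real b = real (\<gamma> + \<alpha>)" "real c = real (\<beta> + \<alpha>)"
    using assms(2-4) by (simp_all add: alpha_def beta_def gamma_def field_simps)
  hence abc: "a = \<beta> + \<gamma>" "b = \<gamma> + \<alpha>" "c = \<beta> + \<alpha>" by (simp_all only: of_nat_eq_iff)
  let ?\<chi> = "central_function a b c"
  have expressed: "expressed_by ?\<chi> p \<longleftrightarrow> (\<forall>x1 x2. det x1 = 1 \<longrightarrow> det x2 = 1 \<longrightarrow>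
      ?\<chi> x1 x2 = poly3_eval p (trace x1) (trace x2) (pair_trace x1 x2))" for p
    by (simp add: expressed_by_def SL2_def pair_trace_def matrix_inv_adj22)
  obtain A where A: "poly_function A" "\<And>x1 x2. det x1 = 1 \<Longrightarrow> det x2 = 1 \<Longrightarrow>
      ?\<chi> x1 x2 = A (trace x1) (trace x2) (pair_trace x1 x2)"
    unfolding abc using central_function_poly_function[of \<beta> \<gamma> \<alpha>] by blast
  have "\<exists>p. expressed_by ?\<chi> p"
    using A unfolding expressed poly_function_def by metis
  moreover have "p = p'" if p: "expressed_by ?\<chi> p" "expressed_by ?\<chi> p'" for p p'
  proof (rule poly3_eqI)
    fix x y z
    \<comment> \<open>A root of \<open>t\<^sup>2 - y t + 1\<close>, the eigenvalue that gives the normal form the trace \<open>y\<close>.\<close>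
    define q where "q = (y + csqrt (y^2 - 4)) / 2"
    have q: "q * (y - q) = 1"
    proof -
      have "csqrt (y^2 - 4) ^ 2 = y^2 - 4" by simp
      thus ?thesis unfolding q_def by (simp add: power2_eq_square field_simps)
    qed
    hence "q \<noteq> 0" by auto
    moreover from this q have "q + 1 / q = y" by (simp add: field_simps)
    ultimately have "det (slice1 x) = 1" "det (slice2 x z q) = 1"
      "trace (slice1 x) = x" "trace (slice2 x z q) = y" "pair_trace (slice1 x) (slice2 x z q) = z"
      by (simp_all add: slice1_def slice2_def det_mat22 trace_mat22 pair_trace_mat22)
    thus "poly3_eval p x y z = poly3_eval p' x y z"
      using p unfolding expressed by metis
  qed
  moreover have "total_degree_less (p - poly3_monom \<beta> \<alpha> \<gamma>) (\<alpha> + \<beta> + \<gamma>)" if p: "expressed_by ?\<chi> p" for p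
  proof (rule total_degree_less_if_tendsto)
    fix \<xi> \<eta> \<zeta> :: complex assume "\<eta> \<noteq> 0"
    define x1 x2 where "x1 \<nu> = mat22 (\<xi> / \<nu>^2) (- \<nu>) (1 / \<nu>) 0"
      and "x2 \<nu> = mat22 (\<eta> / \<nu>^2) ((\<nu>^2 * \<xi> / \<eta> - \<zeta>) / \<nu>) 0 (\<nu>^2 / \<eta>)" for \<nu>
    let ?n = "2 * (\<alpha> + \<beta> + \<gamma>)"
    have "((\<lambda>\<nu>. \<nu> ^ ?n * ?\<chi> (x1 \<nu>) (x2 \<nu>)) \<longlongrightarrow> \<xi> ^ \<beta> * \<eta> ^ \<alpha> * \<zeta> ^ \<gamma>) (at 0)"
      unfolding abc x1_def x2_def by (rule central_function_leading_term[OF \<open>\<eta> \<noteq> 0\<close>])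
    moreover have "((\<lambda>\<nu>. \<xi> ^ \<beta> * (\<eta> + \<nu> ^ 4 / \<eta>) ^ \<alpha> * \<zeta> ^ \<gamma>) \<longlongrightarrow>
        \<xi> ^ \<beta> * (\<eta> + 0 ^ 4 / \<eta>) ^ \<alpha> * \<zeta> ^ \<gamma>) (at 0)"
      by (intro tendsto_intros \<open>\<eta> \<noteq> 0\<close>)
    ultimately have "((\<lambda>\<nu>. \<nu> ^ ?n * ?\<chi> (x1 \<nu>) (x2 \<nu>) - \<xi> ^ \<beta> * (\<eta> + \<nu> ^ 4 / \<eta>) ^ \<alpha> * \<zeta> ^ \<gamma>) \<longlongrightarrow>
        \<xi> ^ \<beta> * \<eta> ^ \<alpha> * \<zeta> ^ \<gamma> - \<xi> ^ \<beta> * (\<eta> + 0 ^ 4 / \<eta>) ^ \<alpha> * \<zeta> ^ \<gamma>) (at 0)"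
      by (rule tendsto_diff)
    hence lim: "((\<lambda>\<nu>. \<nu> ^ ?n * ?\<chi> (x1 \<nu>) (x2 \<nu>) - \<xi> ^ \<beta> * (\<eta> + \<nu> ^ 4 / \<eta>) ^ \<alpha> * \<zeta> ^ \<gamma>) \<longlongrightarrow> 0) (at 0)"
      by simp
    have eq: "\<nu> ^ ?n * ?\<chi> (x1 \<nu>) (x2 \<nu>) - \<xi> ^ \<beta> * (\<eta> + \<nu> ^ 4 / \<eta>) ^ \<alpha> * \<zeta> ^ \<gamma> =
        \<nu> ^ ?n * poly3_eval (p - poly3_monom \<beta> \<alpha> \<gamma>) (\<xi> / \<nu>^2) (\<eta> / \<nu>^2 + \<nu>^2 / \<eta>) (\<zeta> / \<nu>^2)"
      if "\<nu> \<noteq> 0" for \<nu>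
    proof -
      have "det (x1 \<nu>) = 1" "det (x2 \<nu>) = 1" "trace (x1 \<nu>) = \<xi> / \<nu>^2"
        "trace (x2 \<nu>) = \<eta> / \<nu>^2 + \<nu>^2 / \<eta>" "pair_trace (x1 \<nu>) (x2 \<nu>) = \<zeta> / \<nu>^2"
        using that \<open>\<eta> \<noteq> 0\<close> by (simp_all add: x1_def x2_def det_mat22 trace_mat22 pair_trace_mat22
            field_simps power2_eq_square)
      hence "?\<chi> (x1 \<nu>) (x2 \<nu>) = poly3_eval p (\<xi> / \<nu>^2) (\<eta> / \<nu>^2 + \<nu>^2 / \<eta>) (\<zeta> / \<nu>^2)"
        using p unfolding expressed by metis
      moreover have "\<nu> ^ ?n * ((\<xi> / \<nu>^2) ^ \<beta> * (\<eta> / \<nu>^2 + \<nu>^2 / \<eta>) ^ \<alpha> * (\<zeta> / \<nu>^2) ^ \<gamma>) =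
          \<xi> ^ \<beta> * (\<eta> + \<nu> ^ 4 / \<eta>) ^ \<alpha> * \<zeta> ^ \<gamma>"
      proof -
        have split: "\<nu> ^ ?n = (\<nu>^2) ^ \<beta> * (\<nu>^2) ^ \<alpha> * (\<nu>^2) ^ \<gamma>"
          by (simp only: power_mult power_add) (simp only: mult_ac)
        have 1: "(\<nu>^2) ^ \<beta> * (\<xi> / \<nu>^2) ^ \<beta> = \<xi> ^ \<beta>" "(\<nu>^2) ^ \<gamma> * (\<zeta> / \<nu>^2) ^ \<gamma> = \<zeta> ^ \<gamma>"
          using that by (simp_all flip: power_mult_distrib)
        have "\<nu>^2 * (\<eta> / \<nu>^2 + \<nu>^2 / \<eta>) = \<eta> + \<nu> ^ 4 / \<eta>"
          using that \<open>\<eta> \<noteq> 0\<close> by (simp add: field_simps flip: power_add)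
        hence 2: "(\<nu>^2) ^ \<alpha> * (\<eta> / \<nu>^2 + \<nu>^2 / \<eta>) ^ \<alpha> = (\<eta> + \<nu> ^ 4 / \<eta>) ^ \<alpha>"
          by (metis power_mult_distrib)
        show ?thesis unfolding split 1[symmetric] 2[symmetric] by (simp only: mult_ac)
      qed
      ultimately show ?thesis
        by (simp add: poly3_eval_diff poly3_monom_def poly3_eval_single right_diff_distrib)
    qed
    have "\<forall>\<^sub>F \<nu> in at 0. \<nu> ^ ?n * ?\<chi> (x1 \<nu>) (x2 \<nu>) - \<xi> ^ \<beta> * (\<eta> + \<nu> ^ 4 / \<eta>) ^ \<alpha> * \<zeta> ^ \<gamma> =
        \<nu> ^ ?n * poly3_eval (p - poly3_monom \<beta> \<alpha> \<gamma>) (\<xi> / \<nu>^2) (\<eta> / \<nu>^2 + \<nu>^2 / \<eta>) (\<zeta> / \<nu>^2)"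
      using eq by (simp add: eventually_at_filter)
    from Lim_transform_eventually[OF lim this]
    show "((\<lambda>\<nu>. \<nu> ^ ?n * poly3_eval (p - poly3_monom \<beta> \<alpha> \<gamma>)
        (\<xi> / \<nu>^2) (\<eta> / \<nu>^2 + \<nu>^2 / \<eta>) (\<zeta> / \<nu>^2)) \<longlongrightarrow> 0) (at 0)" .
  qed
  ultimately show ?thesis by blast
qed

end
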